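(* Let $n,m,N$ be positive integers, let $A\in c_0(\mathbb{Z}^n)^N$ be an index set, let $C(A)\subset\mathbb{C}^N$ be the Sobolev moment cone, and let $\gamma$ be some reference measure on $\ell_2(\mathbb{Z}^n)$ whose moments can be easily calculated (e.g. a Gaussian measure). For all $r,\rho\in\mathbb{N}$, the set $C^{\mathrm{inn}}_{r,\rho}(A)$ is a semidefinite representable inner approximation of $C(A)$, i.e. it is semidefinite representable and $C^{\mathrm{inn}}_{r,\rho}(A)\subseteq C(A)$.
   Context: Setting. $\mathbb{N}$ includes $0$. $T^n=\mathbb{R}^n/\mathbb{Z}^n$ is the unit torus; for $a\in\mathbb{Z}^n$, $e_a(x):=e^{-2\pi \mathbf{i}\langle a,x\rangle}$, and the Fourier coefficients of $f\in L^2(T^n)$, $f:T^n\to\mathbb{C}$, are $c_a=\langle f,e_a\rangle_{L^2}:=\int_{T^n}f(x)e_a(x)dx$; $Ff:=(c_a)_{a\in\mathbb{Z}^n}\in\ell_2(\mathbb{Z}^n)$. Put $w_a:=(1+\langle a,a\rangle)^m$ and $\|f\|^2_{H^m(T^n)}:=\sum_{a\in\mathbb{Z}^n}w_a|c_a|^2$. $H^m(T^n)$ is the Sobolev space of functions $f:T^n\to\mathbb{C}$ in $L^2$ with $\|f\|_{H^m(T^n)}<\infty$, $B:=\{f\in H^m(T^n):\|f\|_{H^m(T^n)}\le1\}$, with the topology inherited from $L^2(T^n)$, and $E:=FB\subset\ell_2(\mathbb{Z}^n)$. "Measure" means non-negative Radon measure (locally finite and tight). $c_0(\mathbb{Z}^n)$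 is the set of finite collections $\mathbf a$ of elements of $\mathbb{Z}^n$, repetitions allowed, including $\emptyset$. The algebraic degree $d_{\mathbf a}$ is the number of terms of $\mathbf a$; the harmonic degree is $\delta_{\mathbf a}:=\max_{a\in\mathbf a}\max_i|a_i|$ (and $0$ for $\emptyset$); for $a\in\mathbb{Z}^n$, $\delta_a:=\max_i|a_i|$. Moment cone. $C(A):=\{(y_{\mathbf a})_{\mathbf a\in A}: y_{\mathbf a}=\int_B\prod_{a\in\mathbf a}\langle f,e_a\rangle_{L^2}\,d\mu(f)\text{ for some measure }\mu\text{ supported on }B\}$. Inner cone. $\mathbb{C}[c]$ is the ring of complex polynomials in the indeterminates $c=(c_a)_{a\in\mathbb{Z}^n}$ with monomials $c^{\mathbf a}:=\prod_{a\in\mathbf a}c_a$; the squared modulus $|c_a|^2$ is written as the monomial $c_ac_{-a}$, and $q^*$ denotes the Hermitian conjugate of $q\in\mathbb{C}[c]$ (conjugate the coefficients and set $c_a^*=c_{-a}$). The degrees $d(p),\delta(p)$ of a polynomial are the maxima of $d_{\mathbf a},\delta_{\mathbf a}$ over its monomials. $\mathbb{C}[c]_{r,\rho}:=\{p:d(p)\le r,\ \delta(p)\le\rho\}$, $\Sigma_{r,\rho}:=\{\sum_kq_k^*q_k:q_k\in\mathbb{C}[c]_{r,\rho}\}$ (finite sums; $\Sigma_{-1,\rho}:=\{0\}$), and $Q_{r,\rho}:=\{s_0+s_1(1-\sum_{a\in\mathbb{Z}^n,\delta_a\le\rho}w_a|c_a|^2):s_0\in\Sigma_{r,\rho},\ s_1\in\Sigma_{r-1,\rho}\}$.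 Then $C^{\mathrm{inn}}_{r,\rho}(A):=\{(y_{\mathbf a})_{\mathbf a\in A}: y_{\mathbf a}=\int_Ec^{\mathbf a}p(c)\,d\gamma(c)\text{ for some }p\in Q_{r,\rho}\}$. A set is semidefinite representable if it is a projection of a spectrahedron, i.e. of an affine section of the semidefinite cone.
   Formalization: Added assumption: γ-almost every c in E satisfies c_{-a} = conj(c_a), as the convention |c_a|^2 = c_a c_{-a} requires; without it the inclusion fails, e.g. for γ the Dirac mass at c_0 = i/2, A = (∅), q = c_0, where y_∅ = -1/4. *)

theory Defs
  imports "HOL-Analysis.Analysis" "HOL-Library.Poly_Mapping"
begin

section \<open>Auxiliary inequalities\<close>

lemma norm_add_sq_le:
  fixes x y :: "'a::real_normed_vector"
  assumes "t > (0::real)"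
  shows "(norm (x + y))\<^sup>2 \<le> (1 + t) * (norm x)\<^sup>2 + (1 + 1 / t) * (norm y)\<^sup>2"
proof -
  have "(norm (x + y))\<^sup>2 \<le> (norm x + norm y)\<^sup>2"
    by (intro power_mono norm_triangle_ineq) auto
  also have "(1 + t) * (norm x)\<^sup>2 + (1 + 1 / t) * (norm y)\<^sup>2 - (norm x + norm y)\<^sup>2
      = (t * norm x - norm y)\<^sup>2 / t"
    using assms by (simp add: field_simps power2_eq_square)
  then have "(norm x + norm y)\<^sup>2 \<le> (1 + t) * (norm x)\<^sup>2 + (1 + 1 / t) * (norm y)\<^sup>2"
    using assms by (smt (verit) divide_nonneg_nonneg zero_le_power2)
  finally show ?thesis .
qed

lemma sqrt_le_add_of_scaled:
  fixes a b s :: real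
  assumes a: "a \<ge> 0" and b: "b \<ge> 0"
    and s: "\<And>t. t > 0 \<Longrightarrow> s \<le> (1 + t) * a + (1 + 1 / t) * b"
  shows "sqrt s \<le> sqrt a + sqrt b"
proof -
  have key: "sqrt s \<le> sqrt a' + sqrt b'" if "a' > a" "b' > b" for a' b'
  proof -
    define p q where "p = sqrt a'" and "q = sqrt b'"
    have pq: "p > 0" "q > 0" "a' = p\<^sup>2" "b' = q\<^sup>2" using that a b by (auto simp: p_def q_def)
    have "s \<le> (1 + q / p) * a + (1 + p / q) * b" using s[of "q / p"] pq by simp
    also have "\<dots> \<le> (1 + q / p) * p\<^sup>2 + (1 + p / q) * q\<^sup>2"
      using that pq by (intro add_mono mult_left_mono) auto
    also have "\<dots> = p * p + p * q + p * q + q * q"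
      using pq by (simp add: distrib_right power2_eq_square)
    also have "\<dots> = (p + q)\<^sup>2" by (simp add: power2_eq_square algebra_simps)
    finally have "sqrt s \<le> p + q" using pq by (intro real_le_lsqrt) auto
    then show ?thesis unfolding p_def q_def .
  qed
  have "((\<lambda>e. sqrt (a + e) + sqrt (b + e)) \<longlongrightarrow> sqrt (a + 0) + sqrt (b + 0)) (at_right 0)"
    by (intro tendsto_intros)
  moreover have "\<forall>\<^sub>F e in at_right 0. sqrt s \<le> sqrt (a + e) + sqrt (b + e)"
    by (rule eventually_at_rightI[of 0 1]) (auto intro: key)
  ultimately have "sqrt s \<le> sqrt (a + 0) + sqrt (b + 0)"
    by (rule tendsto_lowerbound) simp
  then show ?thesis by simp
qed


section \<open>The sequence space \<open>\<ell>\<^sub>2\<close>\<close>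

typedef 'a ell2 = "{c :: 'a \<Rightarrow> complex. (\<lambda>a. (cmod (c a))\<^sup>2) summable_on UNIV}"
  morphisms coord Abs_ell2
  by (rule exI[of _ "\<lambda>_. 0"]) simp

setup_lifting type_definition_ell2

lemma summable_sq_diff:
  fixes c d :: "'a \<Rightarrow> complex"
  assumes "(\<lambda>a. (cmod (c a))\<^sup>2) summable_on UNIV" "(\<lambda>a. (cmod (d a))\<^sup>2) summable_on UNIV"
  shows "(\<lambda>a. (cmod (c a - d a))\<^sup>2) summable_on UNIV"
proof (rule summable_on_comparison_test)
  show "(\<lambda>a. 2 * (cmod (c a))\<^sup>2 + 2 * (cmod (d a))\<^sup>2) summable_on UNIV"
    using assms by (intro summable_on_add summable_on_cmult_right)
  show "(cmod (c a - d a))\<^sup>2 \<le> 2 * (cmod (c a))\<^sup>2 + 2 * (cmod (d a))\<^sup>2" for a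
    using norm_add_sq_le[of 1 "c a" "- d a"] by simp
qed auto

instantiation ell2 :: (type) metric_space
begin

lift_definition dist_ell2 :: "'a ell2 \<Rightarrow> 'a ell2 \<Rightarrow> real"
  is "\<lambda>c d. sqrt (\<Sum>\<^sub>\<infinity>a. (cmod (c a - d a))\<^sup>2)" .

definition uniformity_ell2 :: "('a ell2 \<times> 'a ell2) filter"
  where "uniformity_ell2 = (INF e\<in>{0<..}. principal {(x, y). dist x y < e})"

definition open_ell2 :: "'a ell2 set \<Rightarrow> bool"
  where "open_ell2 S = (\<forall>x\<in>S. \<forall>\<^sub>F (x', y) in uniformity. x' = x \<longrightarrow> y \<in> S)"

instance
proof
  fix x y z :: "'a ell2"
  show "dist x y = 0 \<longleftrightarrow> x = y"
  proof transfer
    fix c d :: "'a \<Rightarrow> complex"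
    assume s: "(\<lambda>a. (cmod (c a))\<^sup>2) summable_on UNIV" "(\<lambda>a. (cmod (d a))\<^sup>2) summable_on UNIV"
    show "sqrt (\<Sum>\<^sub>\<infinity>a. (cmod (c a - d a))\<^sup>2) = 0 \<longleftrightarrow> c = d"
    proof
      assume "sqrt (\<Sum>\<^sub>\<infinity>a. (cmod (c a - d a))\<^sup>2) = 0"
      then have "(\<Sum>\<^sub>\<infinity>a. (cmod (c a - d a))\<^sup>2) \<le> 0" by simp
      then have "(cmod (c a - d a))\<^sup>2 = 0" for a
        using nonneg_infsum_le_0D[of "\<lambda>a. (cmod (c a - d a))\<^sup>2" UNIV a] summable_sq_diff[OF s] by auto
      then show "c = d" by auto
    qed simp
  qed
  show "dist x y \<le> dist x z + dist y z"
  proof transfer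
    fix c d e :: "'a \<Rightarrow> complex"
    assume s: "(\<lambda>a. (cmod (c a))\<^sup>2) summable_on UNIV" "(\<lambda>a. (cmod (d a))\<^sup>2) summable_on UNIV"
      "(\<lambda>a. (cmod (e a))\<^sup>2) summable_on UNIV"
    note S = summable_sq_diff[OF s(1,2)] summable_sq_diff[OF s(1,3)] summable_sq_diff[OF s(2,3)]
    show "sqrt (\<Sum>\<^sub>\<infinity>a. (cmod (c a - d a))\<^sup>2)
      \<le> sqrt (\<Sum>\<^sub>\<infinity>a. (cmod (c a - e a))\<^sup>2) + sqrt (\<Sum>\<^sub>\<infinity>a. (cmod (d a - e a))\<^sup>2)"
    proof (rule sqrt_le_add_of_scaled)
      fix t :: real assume t: "t > 0"
      have "(\<Sum>\<^sub>\<infinity>a. (cmod (c a - d a))\<^sup>2)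
        \<le> (\<Sum>\<^sub>\<infinity>a. (1 + t) * (cmod (c a - e a))\<^sup>2 + (1 + 1 / t) * (cmod (d a - e a))\<^sup>2)"
      proof (rule infsum_mono)
        show "(cmod (c a - d a))\<^sup>2 \<le> (1 + t) * (cmod (c a - e a))\<^sup>2 + (1 + 1 / t) * (cmod (d a - e a))\<^sup>2" for a
          using norm_add_sq_le[OF t, of "c a - e a" "e a - d a"] by (simp add: norm_minus_commute)
      qed (intro S summable_on_add summable_on_cmult_right)+
      also have "\<dots> = (1 + t) * (\<Sum>\<^sub>\<infinity>a. (cmod (c a - e a))\<^sup>2) + (1 + 1 / t) * (\<Sum>\<^sub>\<infinity>a. (cmod (d a - e a))\<^sup>2)"
        by (subst infsum_add) (auto intro!: S summable_on_cmult_right simp: infsum_cmult_right')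
      finally show "(\<Sum>\<^sub>\<infinity>a. (cmod (c a - d a))\<^sup>2) \<le> \<dots>" .
    qed (auto intro: infsum_nonneg)
  qed
qed (simp_all add: uniformity_ell2_def open_ell2_def)

end


section \<open>The space \<open>L\<^sup>2\<close> of the unit torus\<close>

abbreviation real_vec :: "int^'n \<Rightarrow> real^'n"
  where "real_vec a \<equiv> (\<chi> i. real_of_int (a $ i))"

text \<open>Functions on \<open>\<real>\<^sup>n / \<int>\<^sup>n\<close> are \<open>\<int>\<^sup>n\<close>-periodic functions on \<open>\<real>\<^sup>n\<close>; integrals over
  the torus are integrals over the fundamental domain \<open>[0,1]\<^sup>n\<close>.\<close>

abbreviation unit_cube :: "(real^'n) measure"
  where "unit_cube \<equiv> lebesgue_on (cbox 0 1)"

definition torus_L2 :: "(real^'n \<Rightarrow> complex) set"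
  where "torus_L2 = {f. f \<in> borel_measurable lebesgue \<and> (\<forall>x k. f (x + real_vec k) = f x)
    \<and> integrable unit_cube (\<lambda>x. (cmod (f x))\<^sup>2)}"

definition torus_L2_eq :: "(real^'n \<Rightarrow> complex) \<Rightarrow> (real^'n \<Rightarrow> complex) \<Rightarrow> bool"
  where "torus_L2_eq f g \<longleftrightarrow> f \<in> torus_L2 \<and> g \<in> torus_L2 \<and> (AE x in unit_cube. f x = g x)"

quotient_type 'n L2_torus = "real^'n \<Rightarrow> complex" / partial: torus_L2_eq
proof (rule part_equivpI)
  show "\<exists>f :: real^'n \<Rightarrow> complex. torus_L2_eq f f"
    by (rule exI[of _ "\<lambda>_. 0"]) (simp add: torus_L2_eq_def torus_L2_def)
  show "symp (torus_L2_eq :: (real^'n \<Rightarrow> complex) \<Rightarrow> _)"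
  proof (rule sympI)
    fix f g :: "real^'n \<Rightarrow> complex"
    assume "torus_L2_eq f g"
    then have "f \<in> torus_L2" "g \<in> torus_L2" and "AE x in unit_cube. f x = g x"
      unfolding torus_L2_eq_def by blast+
    moreover from this(3) have "AE x in unit_cube. g x = f x" by eventually_elim simp
    ultimately show "torus_L2_eq g f" unfolding torus_L2_eq_def by blast
  qed
  show "transp (torus_L2_eq :: (real^'n \<Rightarrow> complex) \<Rightarrow> _)"
  proof (rule transpI)
    fix f g h :: "real^'n \<Rightarrow> complex"
    assume fg: "torus_L2_eq f g" and gh: "torus_L2_eq g h"
    have "AE x in unit_cube. f x = g x" "AE x in unit_cube. g x = h x"
      using fg gh unfolding torus_L2_eq_def by blast+
    then have "AE x in unit_cube. f x = h x" by eventually_elim simp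
    then show "torus_L2_eq f h" using fg gh unfolding torus_L2_eq_def by blast
  qed
qed

lemma torus_L2_measurable [measurable_dest]:
  "f \<in> torus_L2 \<Longrightarrow> f \<in> borel_measurable unit_cube"
  by (auto simp: torus_L2_def intro: measurable_restrict_space1)

lemma torus_L2_integrable_diff:
  assumes "f \<in> torus_L2" "g \<in> torus_L2"
  shows "integrable unit_cube (\<lambda>x. (cmod (f x - g x))\<^sup>2)"
proof (rule Bochner_Integration.integrable_bound)
  show "integrable unit_cube (\<lambda>x. 2 * (cmod (f x))\<^sup>2 + 2 * (cmod (g x))\<^sup>2)"
    using assms by (auto simp: torus_L2_def)
  have [measurable]: "f \<in> borel_measurable unit_cube" "g \<in> borel_measurable unit_cube"
    using assms by (auto intro: torus_L2_measurable)
  show "(\<lambda>x. (cmod (f x - g x))\<^sup>2) \<in> borel_measurable unit_cube" by measurable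
  have "(cmod (f x - g x))\<^sup>2 \<le> 2 * (cmod (f x))\<^sup>2 + 2 * (cmod (g x))\<^sup>2" for x
    using norm_add_sq_le[of 1 "f x" "- g x"] by simp
  then show "AE x in unit_cube. norm ((cmod (f x - g x))\<^sup>2) \<le> norm (2 * (cmod (f x))\<^sup>2 + 2 * (cmod (g x))\<^sup>2)"
    by simp
qed

instantiation L2_torus :: (finite) metric_space
begin

lift_definition dist_L2_torus :: "'a L2_torus \<Rightarrow> 'a L2_torus \<Rightarrow> real"
  is "\<lambda>f g. sqrt (LINT x|unit_cube. (cmod (f x - g x))\<^sup>2)"
proof -
  fix f f' g g' :: "real^'a \<Rightarrow> complex"
  assume "torus_L2_eq f f'" "torus_L2_eq g g'"
  then have [measurable]: "f \<in> borel_measurable unit_cube" "g \<in> borel_measurable unit_cube"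
      "f' \<in> borel_measurable unit_cube" "g' \<in> borel_measurable unit_cube"
    and ae: "AE x in unit_cube. f x = f' x" "AE x in unit_cube. g x = g' x"
    by (auto simp: torus_L2_eq_def intro: torus_L2_measurable)
  have "(LINT x|unit_cube. (cmod (f x - g x))\<^sup>2) = (LINT x|unit_cube. (cmod (f' x - g' x))\<^sup>2)"
  proof (rule integral_cong_AE)
    show "AE x in unit_cube. (cmod (f x - g x))\<^sup>2 = (cmod (f' x - g' x))\<^sup>2"
      using ae by eventually_elim simp
  qed (measurable)
  then show "sqrt (LINT x|unit_cube. (cmod (f x - g x))\<^sup>2) = sqrt (LINT x|unit_cube. (cmod (f' x - g' x))\<^sup>2)"
    by simp
qed

definition uniformity_L2_torus :: "('a L2_torus \<times> 'a L2_torus) filter"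
  where "uniformity_L2_torus = (INF e\<in>{0<..}. principal {(x, y). dist x y < e})"

definition open_L2_torus :: "'a L2_torus set \<Rightarrow> bool"
  where "open_L2_torus S = (\<forall>x\<in>S. \<forall>\<^sub>F (x', y) in uniformity. x' = x \<longrightarrow> y \<in> S)"

instance
proof
  fix x y z :: "'a L2_torus"
  show "dist x y = 0 \<longleftrightarrow> x = y"
  proof transfer
    fix f g :: "real^'a \<Rightarrow> complex"
    assume "torus_L2_eq f f" "torus_L2_eq g g"
    then have fg: "f \<in> torus_L2" "g \<in> torus_L2" by (auto simp: torus_L2_eq_def)
    show "sqrt (LINT x|unit_cube. (cmod (f x - g x))\<^sup>2) = 0 \<longleftrightarrow> torus_L2_eq f g"
      using integral_nonneg_eq_0_iff_AE[OF torus_L2_integrable_diff[OF fg]] fg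
      by (simp add: torus_L2_eq_def)
  qed
  show "dist x y \<le> dist x z + dist y z"
  proof transfer
    fix f g h :: "real^'a \<Rightarrow> complex"
    assume "torus_L2_eq f f" "torus_L2_eq g g" "torus_L2_eq h h"
    then have fgh: "f \<in> torus_L2" "g \<in> torus_L2" "h \<in> torus_L2" by (auto simp: torus_L2_eq_def)
    note I = torus_L2_integrable_diff[OF fgh(1,2)] torus_L2_integrable_diff[OF fgh(1,3)]
      torus_L2_integrable_diff[OF fgh(2,3)]
    show "sqrt (LINT x|unit_cube. (cmod (f x - g x))\<^sup>2)
      \<le> sqrt (LINT x|unit_cube. (cmod (f x - h x))\<^sup>2) + sqrt (LINT x|unit_cube. (cmod (g x - h x))\<^sup>2)"
    proof (rule sqrt_le_add_of_scaled)
      fix t :: real assume t: "t > 0"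
      have "(LINT x|unit_cube. (cmod (f x - g x))\<^sup>2)
        \<le> (LINT x|unit_cube. (1 + t) * (cmod (f x - h x))\<^sup>2 + (1 + 1 / t) * (cmod (g x - h x))\<^sup>2)"
      proof (rule integral_mono)
        show "(cmod (f x - g x))\<^sup>2 \<le> (1 + t) * (cmod (f x - h x))\<^sup>2 + (1 + 1 / t) * (cmod (g x - h x))\<^sup>2" for x
          using norm_add_sq_le[OF t, of "f x - h x" "h x - g x"] by (simp add: norm_minus_commute)
      qed (intro I Bochner_Integration.integrable_add integrable_mult_right)+
      also have "\<dots> = (1 + t) * (LINT x|unit_cube. (cmod (f x - h x))\<^sup>2)
          + (1 + 1 / t) * (LINT x|unit_cube. (cmod (g x - h x))\<^sup>2)"
        by (subst Bochner_Integration.integral_add) (intro I integrable_mult_right | simp)+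
      finally show "(LINT x|unit_cube. (cmod (f x - g x))\<^sup>2) \<le> \<dots>" .
    qed auto
  qed
qed (simp_all add: uniformity_L2_torus_def open_L2_torus_def)

end


section \<open>Fourier coefficients and the Sobolev ball\<close>

definition fourier_basis :: "int^'n \<Rightarrow> real^'n \<Rightarrow> complex"
  where "fourier_basis a x = exp (- 2 * complex_of_real pi * \<i> * complex_of_real (real_vec a \<bullet> x))"

lemma fourier_basis_measurable [measurable]: "fourier_basis a \<in> borel_measurable unit_cube"
proof -
  have "continuous_on UNIV (fourier_basis a)"
    unfolding fourier_basis_def by (intro continuous_intros)
  then have "fourier_basis a \<in> borel_measurable lborel"
    using borel_measurable_continuous_onI by simp
  then have "fourier_basis a \<in> borel_measurable lebesgue"
    by (rule measurable_completion)
  then show ?thesis by (rule measurable_restrict_space1)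
qed

lift_definition fourier_coeff :: "'n::finite L2_torus \<Rightarrow> int^'n \<Rightarrow> complex"
  is "\<lambda>f a. LINT x|unit_cube. f x * fourier_basis a x"
proof (rule ext)
  fix f g :: "real^'n \<Rightarrow> complex" and a :: "int^'n"
  assume "torus_L2_eq f g"
  then have [measurable]: "f \<in> borel_measurable unit_cube" "g \<in> borel_measurable unit_cube"
    and ae: "AE x in unit_cube. f x = g x"
    by (auto simp: torus_L2_eq_def intro: torus_L2_measurable)
  show "(LINT x|unit_cube. f x * fourier_basis a x) = (LINT x|unit_cube. g x * fourier_basis a x)"
  proof (rule integral_cong_AE)
    show "AE x in unit_cube. f x * fourier_basis a x = g x * fourier_basis a x"
      using ae by eventually_elim simp
  qed (measurable)
qed

definition fourier_map :: "'n::finite L2_torus \<Rightarrow> (int^'n) ell2"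
  where "fourier_map f = Abs_ell2 (fourier_coeff f)"

definition sobolev_weight :: "nat \<Rightarrow> int^'n \<Rightarrow> real"
  where "sobolev_weight m a = (1 + real_vec a \<bullet> real_vec a) ^ m"

definition sobolev_space :: "nat \<Rightarrow> 'n::finite L2_torus set"
  where "sobolev_space m =
    {f. (\<lambda>a. sobolev_weight m a * (cmod (fourier_coeff f a))\<^sup>2) summable_on UNIV}"

definition sobolev_norm :: "nat \<Rightarrow> 'n::finite L2_torus \<Rightarrow> real"
  where "sobolev_norm m f = sqrt (\<Sum>\<^sub>\<infinity>a. sobolev_weight m a * (cmod (fourier_coeff f a))\<^sup>2)"

definition sobolev_ball :: "nat \<Rightarrow> 'n::finite L2_torus set"
  where "sobolev_ball m = {f \<in> sobolev_space m. sobolev_norm m f \<le> 1}"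


section \<open>Radon measures\<close>

text \<open>Tightness is inner regularity with respect to compact sets.\<close>

definition radon_measure :: "'a::t2_space measure \<Rightarrow> bool"
  where "radon_measure \<mu> \<longleftrightarrow> sets \<mu> = sets borel
    \<and> (\<forall>x. \<exists>U. open U \<and> x \<in> U \<and> emeasure \<mu> U < \<infinity>)
    \<and> (\<forall>S\<in>sets borel. emeasure \<mu> S = (SUP K\<in>{K. compact K \<and> K \<subseteq> S}. emeasure \<mu> K))"


section \<open>The moment cone\<close>

text \<open>A finite collection of elements of \<open>\<int>\<^sup>n\<close>, repetitions allowed, is a multiset; an
  \<open>N\<close>-tuple of collections is a vector indexed by a finite type with \<open>N\<close> elements.\<close>

definition moment_cone :: "nat \<Rightarrow> ((int^'n::finite) multiset)^'k \<Rightarrow> (complex^'k) set"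
  where "moment_cone m A = {y. \<exists>\<mu> :: 'n L2_torus measure.
    radon_measure \<mu> \<and> (AE f in \<mu>. f \<in> sobolev_ball m)
    \<and> (\<forall>j. y $ j = (LINT f:sobolev_ball m|\<mu>. \<Prod>a\<in>#A $ j. fourier_coeff f a))}"


section \<open>Polynomials in the Fourier coefficients\<close>

text \<open>The multiset \<open>\<a>\<close> stands for the monomial \<open>c\<^sup>\<a>\<close>, so that the convolution product of
  finitely supported functions on multisets is the product of polynomials.\<close>

type_synonym 'n fpoly = "(int^'n) multiset \<Rightarrow>\<^sub>0 complex"

definition eval_monom :: "((int^'n) ell2) \<Rightarrow> (int^'n) multiset \<Rightarrow> complex"
  where "eval_monom c as = (\<Prod>a\<in>#as. coord c a)"

definition eval_fpoly :: "'n fpoly \<Rightarrow> (int^'n::finite) ell2 \<Rightarrow> complex"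
  where "eval_fpoly p c = (\<Sum>as\<in>Poly_Mapping.keys p. Poly_Mapping.lookup p as * eval_monom c as)"

definition herm_conj :: "'n::finite fpoly \<Rightarrow> 'n fpoly"
  where "herm_conj q = (\<Sum>as\<in>Poly_Mapping.keys q.
    Poly_Mapping.single (image_mset uminus as) (cnj (Poly_Mapping.lookup q as)))"

definition index_degree :: "int^'n::finite \<Rightarrow> nat"
  where "index_degree a = Max (range (\<lambda>i. nat \<bar>a $ i\<bar>))"

definition harmonic_degree :: "(int^'n::finite) multiset \<Rightarrow> nat"
  where "harmonic_degree as = Max (insert 0 (index_degree ` set_mset as))"

definition poly_alg_degree :: "'n::finite fpoly \<Rightarrow> nat"
  where "poly_alg_degree p = Max (insert 0 (size ` Poly_Mapping.keys p))"

definition poly_harm_degree :: "'n::finite fpoly \<Rightarrow> nat"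
  where "poly_harm_degree p = Max (insert 0 (harmonic_degree ` Poly_Mapping.keys p))"

definition bounded_polys :: "nat \<Rightarrow> nat \<Rightarrow> 'n::finite fpoly set"
  where "bounded_polys r \<rho> = {p. poly_alg_degree p \<le> r \<and> poly_harm_degree p \<le> \<rho>}"

definition sos_cone :: "nat \<Rightarrow> nat \<Rightarrow> 'n::finite fpoly set"
  where "sos_cone r \<rho> = {(\<Sum>q\<leftarrow>qs. herm_conj q * q) | qs. set qs \<subseteq> bounded_polys r \<rho>}"

text \<open>The polynomial \<open>1 - \<Sum> w\<^sub>a |c\<^sub>a|\<^sup>2\<close> over \<open>\<delta>\<^sub>a \<le> \<rho>\<close>, where \<open>|c\<^sub>a|\<^sup>2\<close> is the monomial \<open>c\<^sub>a c\<^sub>-\<^sub>a\<close>.\<close>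

definition ball_poly :: "nat \<Rightarrow> nat \<Rightarrow> 'n::finite fpoly"
  where "ball_poly m \<rho> = 1 - (\<Sum>a\<in>{a. index_degree a \<le> \<rho>}.
    Poly_Mapping.single {#a, - a#} (complex_of_real (sobolev_weight m a)))"

definition quadratic_module :: "nat \<Rightarrow> nat \<Rightarrow> nat \<Rightarrow> 'n::finite fpoly set"
  where "quadratic_module m r \<rho> = {s\<^sub>0 + s\<^sub>1 * ball_poly m \<rho> | s\<^sub>0 s\<^sub>1.
    s\<^sub>0 \<in> sos_cone r \<rho> \<and> s\<^sub>1 \<in> (if r = 0 then {0} else sos_cone (r - 1) \<rho>)}"

definition inner_cone ::
  "nat \<Rightarrow> (int^'n::finite) ell2 measure \<Rightarrow> nat \<Rightarrow> nat \<Rightarrow> ((int^'n) multiset)^'k \<Rightarrow> (complex^'k) set"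
  where "inner_cone m \<gamma> r \<rho> A = {y. \<exists>p\<in>quadratic_module m r \<rho>. \<forall>j.
    y $ j = (LINT c:fourier_map ` sobolev_ball m|\<gamma>. eval_monom c (A $ j) * eval_fpoly p c)}"

text \<open>The relation \<open>c\<^sub>-\<^sub>a = cnj c\<^sub>a\<close> behind writing \<open>|c\<^sub>a|\<^sup>2\<close> as \<open>c\<^sub>a c\<^sub>-\<^sub>a\<close> and \<open>c\<^sub>a\<^sup>*\<close> as \<open>c\<^sub>-\<^sub>a\<close>.
  For the Fourier coefficients of a function it says that the function is real-valued.\<close>

definition hermitian_seq :: "(int^'n) ell2 \<Rightarrow> bool"
  where "hermitian_seq c \<longleftrightarrow> (\<forall>a. coord c (- a) = cnj (coord c a))"


section \<open>Semidefinite representable sets\<close>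

definition psd_matrix :: "nat \<Rightarrow> (nat \<Rightarrow> nat \<Rightarrow> real) \<Rightarrow> bool"
  where "psd_matrix k M \<longleftrightarrow> (\<forall>i<k. \<forall>j<k. M i j = M j i)
    \<and> (\<forall>v :: nat \<Rightarrow> real. 0 \<le> (\<Sum>i<k. \<Sum>j<k. v i * M i j * v j))"

text \<open>A spectrahedron in \<open>V \<times> \<real>\<^sup>d\<close>: the points at which an affine family of \<open>k \<times> k\<close> matrices
  is positive semidefinite. Points of \<open>\<real>\<^sup>d\<close> are sequences that vanish from index \<open>d\<close> on.\<close>

definition spectrahedron :: "nat \<Rightarrow> nat \<Rightarrow> (nat \<Rightarrow> nat \<Rightarrow> real) \<Rightarrow> ('v \<Rightarrow> nat \<Rightarrow> nat \<Rightarrow> real)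
    \<Rightarrow> (nat \<Rightarrow> nat \<Rightarrow> nat \<Rightarrow> real) \<Rightarrow> ('v::euclidean_space \<times> (nat \<Rightarrow> real)) set"
  where "spectrahedron k d M\<^sub>0 M L = {(x, u). (\<forall>l\<ge>d. u l = 0)
    \<and> psd_matrix k (\<lambda>i j. M\<^sub>0 i j + (\<Sum>b\<in>Basis. (x \<bullet> b) * M b i j) + (\<Sum>l<d. u l * L l i j))}"

definition semidefinite_representable :: "'v::euclidean_space set \<Rightarrow> bool"
  where "semidefinite_representable S \<longleftrightarrow> (\<exists>k d M\<^sub>0 M L. S = fst ` spectrahedron k d M\<^sub>0 M L)"

end

theory Submission
  imports Defs
begin

text \<open>On the Hermitian points of \<open>E\<close> every polynomial of the quadratic module is a nonnegative real
  number, so it is a density with respect to \<open>\<gamma>\<close> on \<open>E\<close>. This density is bounded and \<open>E\<close> is compact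
  (Rellich), hence it defines a finite Radon measure on \<open>E\<close>. Fourier synthesis \<open>\<ell>\<^sub>2 \<rightarrow> L\<^sup>2\<close> does not
  increase distances and is a right inverse of the Fourier transform, so it carries the measure to a
  Radon measure on the Sobolev ball with the same moments. Only the orthonormality of the exponentials
  and the completeness of \<open>L\<^sup>2\<close> are needed for this, not the completeness of the Fourier system.

  For the semidefinite representation, in real coordinates \<open>x\<close> of a polynomial \<open>q\<close> of bounded degree the
  moments of \<open>q\<^sup>* q b\<close> form a vector-valued quadratic form in \<open>x\<close>, and finite sums of the matrices
  \<open>x x\<^sup>T\<close> are exactly the positive semidefinite matrices.\<close>

section \<open>Sums of squares and positive semidefinite matrices\<close>

text \<open>The Hermitian condition is what makes the density real: \<open>herm_conj q * q\<close>
  evaluates to a squared modulus only where the coordinates at a and -a are conjugate, and only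
  there is the monomial \<open>{#a, - a#}\<close> equal to |c_a|^2. Identities that involve
  \<open>herm_conj\<close> or \<open>ball_poly\<close> are therefore available only almost
  everywhere on E.

  Integrability is the other recurring obligation. A Bochner integral of a non-integrable function
  is 0 by convention, so moments are additive in the density only because all integrands are
  integrable: \<open>\<gamma>\<close> is merely locally finite, but it is finite on the compact set
  E, where continuous functions are bounded. Compactness of E thus serves the semidefinite
  representation as much as the construction of the measure.

  Coefficients are complex while spectrahedra are real. Instead of a Hermitian Gram matrix of the
  coefficients of q, a real symmetric one of twice the size is used; the two summands of the
  quadratic module then occupy two diagonal blocks.\<close>

lemma quadratic_form_Suc:
  fixes M :: "nat \<Rightarrow> nat \<Rightarrow> real"
  assumes "\<And>i. i < k \<Longrightarrow> M k i = M i k"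
  shows "(\<Sum>i<Suc k. \<Sum>j<Suc k. v i * M i j * v j) =
    (\<Sum>i<k. \<Sum>j<k. v i * M i j * v j) + 2 * v k * (\<Sum>i<k. v i * M i k) + (v k)\<^sup>2 * M k k"
proof -
  have "(\<Sum>j<k. v k * M k j * v j) = v k * (\<Sum>i<k. v i * M i k)"
    using assms by (simp add: sum_distrib_left mult_ac)
  moreover have "(\<Sum>i<k. v i * M i k * v k) = v k * (\<Sum>i<k. v i * M i k)"
    by (simp add: sum_distrib_left mult_ac)
  ultimately show ?thesis by (simp add: sum.distrib power2_eq_square)
qed

text \<open>Symmetric Gaussian elimination, by induction on the size. A positive last pivot is
  removed by subtracting the outer product of the scaled last column, which leaves a positive
  semidefinite Schur complement; a zero pivot forces the whole last column to vanish.\<close>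

lemma psd_matrix_gram:
  assumes "psd_matrix k M"
  shows "\<exists>xs :: (nat \<Rightarrow> real) list. \<forall>i<k. \<forall>j<k. M i j = (\<Sum>x\<leftarrow>xs. x i * x j)"
  using assms
proof (induction k arbitrary: M)
  case 0
  then show ?case by simp
next
  case (Suc k)
  define Q where "Q M v = (\<Sum>i<k. \<Sum>j<k. v i * M i j * v j)" for M and v :: "nat \<Rightarrow> real"
  define B where "B v = (\<Sum>i<k. v i * M i k)" for v
  define d where "d = M k k"
  have sym: "M i j = M j i" if "i < Suc k" "j < Suc k" for i j
    using Suc.prems that by (auto simp: psd_matrix_def)
  \<comment> \<open>The form at the vector (v, t), read as a quadratic polynomial in t.\<close>
  have pos: "0 \<le> Q M v + 2 * t * B v + t\<^sup>2 * d" for v t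
  proof -
    have "0 \<le> (\<Sum>i<Suc k. \<Sum>j<Suc k. (v(k := t)) i * M i j * (v(k := t)) j)"
      using Suc.prems unfolding psd_matrix_def by blast
    also have "\<dots> = Q M v + 2 * t * B v + t\<^sup>2 * d"
      by (subst quadratic_form_Suc) (auto simp: Q_def B_def d_def intro: sym)
    finally show ?thesis .
  qed
  \<comment> \<open>A decomposition of a smaller matrix survives bordering by zeros: every vector
    gets the entry 0 at index \<open>k\<close>.\<close>
  have extend: "\<exists>ys. \<forall>i<Suc k. \<forall>j<Suc k.
      (if i < k \<and> j < k then N i j else 0) = (\<Sum>x\<leftarrow>ys. x i * x j)"
    if N: "psd_matrix k N" for N
  proof -
    obtain xs :: "(nat \<Rightarrow> real) list" where "\<forall>i<k. \<forall>j<k. N i j = (\<Sum>x\<leftarrow>xs. x i * x j)"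
      using Suc.IH[OF N] by blast
    then show ?thesis
      by (intro exI[of _ "map (\<lambda>x. x(k := 0)) xs"]) (auto simp: less_Suc_eq comp_def)
  qed
  have "d \<ge> 0" using pos[of "\<lambda>_. 0" 1] by (simp add: Q_def B_def)
  then consider "d = 0" | "d > 0" by linarith
  then show ?case
  proof cases
    case 1
    have "B v = 0" for v
    proof (rule ccontr)
      assume "B v \<noteq> 0"
      \<comment> \<open>For \<open>d = 0\<close> the expression is affine in t, and this t gives it
        the value -1.\<close>
      then show False using pos[of v "- (Q M v + 1) / (2 * B v)"] 1 by (simp add: field_simps)
    qed
    then have "M i k = 0" if "i < k" for i
      using that \<open>\<And>v. B v = 0\<close>[of "\<lambda>j. if j = i then 1 else 0"] by (simp add: B_def if_distrib[of "\<lambda>x. x * _"] cong: if_cong)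
    then have M0: "M i j = (if i < k \<and> j < k then M i j else 0)" if "i < Suc k" "j < Suc k" for i j
      using that sym[of i j] 1 d_def by (auto simp: less_Suc_eq)
    have "psd_matrix k M"
      using pos[of _ 0] sym by (auto simp: psd_matrix_def Q_def)
    from extend[OF this] M0 show ?thesis by fastforce
  next
    case 2
    \<comment> \<open>The Schur complement of the pivot \<open>d\<close>.\<close>
    define N where "N i j = M i j - M i k * M j k / d" for i j
    have "Q N v = Q M v - (B v)\<^sup>2 / d" for v
      unfolding Q_def N_def B_def power2_eq_square sum_product sum_divide_distrib
      by (simp add: sum_subtractf algebra_simps)
    \<comment> \<open>The choice t = - B v / d minimises the quadratic polynomial in t.\<close>
    moreover have "0 \<le> Q M v - (B v)\<^sup>2 / d" for v
      using pos[of v "- B v / d"] 2 by (simp add: power2_eq_square field_simps)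
    ultimately have "psd_matrix k N"
      unfolding psd_matrix_def using sym by (auto simp: N_def Q_def)
    from extend[OF this] obtain ys where ys:
      "\<forall>i<Suc k. \<forall>j<Suc k. (if i < k \<and> j < k then N i j else 0) = (\<Sum>x\<leftarrow>ys. x i * x j)" by blast
    have "M i j = (\<Sum>x\<leftarrow>(\<lambda>i. M i k / sqrt d) # ys. x i * x j)" if "i < Suc k" "j < Suc k" for i j
    proof -
      have "(\<Sum>x\<leftarrow>(\<lambda>i. M i k / sqrt d) # ys. x i * x j)
        = M i k * M j k / d + (if i < k \<and> j < k then N i j else 0)"
        using ys that 2 by simp
      also have "\<dots> = M i j"
        using that 2 sym[of k j] by (auto simp: N_def d_def less_Suc_eq)
      finally show ?thesis by simp
    qed
    then show ?thesis by blast
  qed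
qed

lemma psd_matrix_sum_outer: "psd_matrix k (\<lambda>i j. \<Sum>x\<leftarrow>xs. x i * x j)"
proof -
  have "(\<Sum>i<k. \<Sum>j<k. v i * (\<Sum>x\<leftarrow>xs. x i * x j) * v j) = (\<Sum>x\<leftarrow>xs. (\<Sum>i<k. v i * x i)\<^sup>2)"
    for v :: "nat \<Rightarrow> real"
    by (induction xs) (simp_all add: sum.distrib power2_eq_square sum_product algebra_simps)
  then show ?thesis
    unfolding psd_matrix_def by (auto simp: mult.commute intro!: sum_list_nonneg)
qed

text \<open>The convex cone generated by the values of the vector-valued quadratic form with
  coefficients \<open>z\<close>, which need not be symmetric.\<close>

definition sos_values :: "nat \<Rightarrow> (nat \<Rightarrow> nat \<Rightarrow> 'v) \<Rightarrow> 'v::real_vector set"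
  where "sos_values k z = {(\<Sum>x\<leftarrow>xs. \<Sum>i<k. \<Sum>j<k. (x i * x j) *\<^sub>R z i j) | xs. True}"

text \<open>The value depends linearly on the Gram matrix of the list of vectors, and Gram matrices
  are exactly the positive semidefinite ones; so the cone is a linear image of the semidefinite
  cone.\<close>

lemma sos_values_eq_psd_image:
  "sos_values k z = {\<Sum>i<k. \<Sum>j<k. G i j *\<^sub>R z i j | G. psd_matrix k G}"
proof -
  have swap: "(\<Sum>x\<leftarrow>xs. \<Sum>i<k. \<Sum>j<k. (x i * x j) *\<^sub>R z i j)
    = (\<Sum>i<k. \<Sum>j<k. (\<Sum>x\<leftarrow>xs. x i * x j) *\<^sub>R z i j)" for xs :: "(nat \<Rightarrow> real) list"
    by (induction xs) (simp_all add: sum.distrib scaleR_left_distrib)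
  show ?thesis
  proof (intro equalityI subsetI)
    fix y assume "y \<in> sos_values k z"
    then show "y \<in> {\<Sum>i<k. \<Sum>j<k. G i j *\<^sub>R z i j | G. psd_matrix k G}"
      unfolding sos_values_def swap using psd_matrix_sum_outer by fastforce
  next
    fix y assume "y \<in> {\<Sum>i<k. \<Sum>j<k. G i j *\<^sub>R z i j | G. psd_matrix k G}"
    then obtain G where G: "psd_matrix k G" "y = (\<Sum>i<k. \<Sum>j<k. G i j *\<^sub>R z i j)" by blast
    obtain xs :: "(nat \<Rightarrow> real) list" where "\<forall>i<k. \<forall>j<k. G i j = (\<Sum>x\<leftarrow>xs. x i * x j)"
      using psd_matrix_gram[OF G(1)] by blast
    then have "y = (\<Sum>x\<leftarrow>xs. \<Sum>i<k. \<Sum>j<k. (x i * x j) *\<^sub>R z i j)"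
      unfolding swap G(2) by simp
    then show "y \<in> sos_values k z" unfolding sos_values_def by blast
  qed
qed

section \<open>Lifting a linear image of the semidefinite cone to a spectrahedron\<close>

lemma psd_matrix_diag_nonneg:
  assumes "psd_matrix k M" "i < k"
  shows "0 \<le> M i i"
proof -
  have "0 \<le> (\<Sum>a<k. \<Sum>b<k. (if a = i then 1 else 0) * M a b * (if b = i then 1 else 0))"
    using assms(1) unfolding psd_matrix_def by (auto dest: spec[of _ "\<lambda>a. if a = i then 1 else 0"])
  also have "\<dots> = M i i" using assms(2) by (simp add: if_distrib[of "\<lambda>x. x * _"] if_distrib[of "\<lambda>x. _ * x"] cong: if_cong)
  finally show ?thesis .
qed

lemma sum_leading_block:
  fixes f :: "nat \<Rightarrow> nat \<Rightarrow> 'a::comm_monoid_add"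
  assumes "k \<le> l"
  shows "(\<Sum>i<l. \<Sum>j<l. if i < k \<and> j < k then f i j else 0) = (\<Sum>i<k. \<Sum>j<k. f i j)"
proof -
  have *: "(\<Sum>i<l. if i < k then g i else 0) = (\<Sum>i<k. g i)" for g :: "nat \<Rightarrow> 'a"
    using assms by (simp flip: sum.inter_filter) (auto intro!: sum.cong)
  have "(\<Sum>i<l. \<Sum>j<l. if i < k \<and> j < k then f i j else 0)
    = (\<Sum>i<l. if i < k then \<Sum>j<l. if j < k then f i j else 0 else 0)"
    by (intro sum.cong refl) auto
  then show ?thesis by (simp add: *)
qed

lemma psd_matrix_extend_zero:
  assumes "psd_matrix k G" "k \<le> l"
  shows "psd_matrix l (\<lambda>i j. if i < k \<and> j < k then G i j else 0)"
proof -
  have "(\<Sum>i<l. \<Sum>j<l. v i * (if i < k \<and> j < k then G i j else 0) * v j)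
      = (\<Sum>i<k. \<Sum>j<k. v i * G i j * v j)" for v
    by (subst sum_leading_block[OF assms(2), symmetric]) (auto intro!: sum.cong)
  then show ?thesis using assms unfolding psd_matrix_def by auto
qed

lemma psd_matrix_leading_block:
  assumes "psd_matrix l M" "k \<le> l"
  shows "psd_matrix k M"
proof -
  have "0 \<le> (\<Sum>i<k. \<Sum>j<k. v i * M i j * v j)" for v
  proof -
    define w where "w i = (if i < k then v i else 0)" for i
    have "0 \<le> (\<Sum>i<l. \<Sum>j<l. w i * M i j * w j)"
      using assms(1) unfolding psd_matrix_def by blast
    also have "\<dots> = (\<Sum>i<k. \<Sum>j<k. v i * M i j * v j)"
      by (subst sum_leading_block[OF assms(2), symmetric]) (auto intro!: sum.cong simp: w_def)
    finally show ?thesis .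
  qed
  then show ?thesis using assms unfolding psd_matrix_def by auto
qed

text \<open>The equation \<open>x = \<Sum> G\<^sub>i\<^sub>j z\<^sub>i\<^sub>j\<close> becomes a pair of opposite inequalities per coordinate, placed on
  the diagonal below the block \<open>G\<close>; the entries of \<open>G\<close> are the lifting variables.\<close>

lemma semidefinite_representable_sos_values:
  fixes z :: "nat \<Rightarrow> nat \<Rightarrow> 'v::euclidean_space"
  shows "semidefinite_representable (sos_values k z)"
proof -
  obtain bs :: "'v list" where bs: "set bs = Basis" "distinct bs"
    using finite_distinct_list[OF finite_Basis] by blast
  define n where "n = length bs"
  define l where "l = k + 2 * n"
  \<comment> \<open>Diagonal positions k, ..., k + n - 1 carry the inequalities with sign +1 and the
    next n positions the same ones with sign -1; \<open>e i\<close> is the basis vector belonging to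
    position i.\<close>
  define sgn where "sgn i = (if i < k then 0 else if i < k + n then 1 else - 1 :: real)" for i
  define e where "e i = bs ! (if i < k + n then i - k else i - k - n)" for i
  define M where "M b i j = (if i = j \<and> e i = b then sgn i else 0)" for b i j
  \<comment> \<open>Variable t is the entry of G in row \<open>t div k\<close> and column
    \<open>t mod k\<close>. The first summand puts it into the block, the second one subtracts its
    contribution to x from the diagonal.\<close>
  define L where "L t i j = (if i < k \<and> j < k \<and> t = i * k + j then 1 else 0)
    - (if i = j then sgn i * (z (t div k) (t mod k) \<bullet> e i) else 0)" for t i j :: nat
  define zu where "zu u = (\<Sum>t<k * k. u t *\<^sub>R z (t div k) (t mod k))" for u :: "nat \<Rightarrow> real"
  define X where "X x u i j = 0 + (\<Sum>b\<in>Basis. (x \<bullet> b) * M b i j) + (\<Sum>t<k * k. u t * L t i j)"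
    for x :: 'v and u :: "nat \<Rightarrow> real" and i j
  have lt: "i * k + j < k * k" if "i < k" "j < k" for i j
  proof -
    have "i * k + j < Suc i * k" using that by simp
    also have "\<dots> \<le> k * k" using that by (intro mult_le_mono1 Suc_leI)
    finally show ?thesis .
  qed
  have e: "e i \<in> Basis" if "k \<le> i" "i < l" for i
    using that bs(1) nth_mem[of _ bs] by (auto simp: e_def l_def n_def)
  have X: "X x u i j = (if i < k \<and> j < k then u (i * k + j)
      else if i = j then sgn i * ((x - zu u) \<bullet> e i) else 0)" if "i < l" for x u i j
  proof -
    have "(\<Sum>b\<in>Basis. (x \<bullet> b) * M b i j) = (if i = j then sgn i * (x \<bullet> e i) else 0)"
    proof (cases "i < k")
      case True
      then show ?thesis by (auto simp: M_def sgn_def intro!: sum.neutral)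
    next
      case False
      have "(\<Sum>b\<in>Basis. (x \<bullet> b) * M b i j)
        = (\<Sum>b\<in>Basis. if b = e i then (if i = j then sgn i * (x \<bullet> e i) else 0) else 0)"
        by (intro sum.cong) (auto simp: M_def)
      then show ?thesis using e[of i] False that by simp
    qed
    moreover have "(\<Sum>t<k * k. u t * L t i j) = (if i < k \<and> j < k then u (i * k + j) else 0)
      - (if i = j then sgn i * (zu u \<bullet> e i) else 0)"
    proof -
      have "(\<Sum>t<k * k. u t * L t i j)
        = (\<Sum>t<k * k. if t = i * k + j then if i < k \<and> j < k then u t else 0 else 0)
        - (\<Sum>t<k * k. if i = j then sgn i * ((u t *\<^sub>R z (t div k) (t mod k)) \<bullet> e i) else 0)"
        unfolding sum_subtractf[symmetric] by (intro sum.cong) (auto simp: L_def algebra_simps)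
      then show ?thesis using lt[of i j] by (auto simp: zu_def inner_sum_left sum_distrib_left)
    qed
    ultimately show ?thesis
      by (auto simp: X_def inner_diff_left right_diff_distrib sgn_def)
  qed
  have zu: "zu u = (\<Sum>i<k. \<Sum>j<k. u (i * k + j) *\<^sub>R z i j)" for u
  proof -
    have "(\<Sum>i<k. \<Sum>j<k. u (i * k + j) *\<^sub>R z i j)
      = (\<Sum>(i, j)\<in>{..<k} \<times> {..<k}. u (i * k + j) *\<^sub>R z i j)"
      by (simp add: sum.cartesian_product)
    also have "\<dots> = zu u"
      unfolding zu_def
      by (rule sum.reindex_bij_witness[of _ "\<lambda>t. (t div k, t mod k)" "\<lambda>(i, j). i * k + j"])
        (auto simp: lt less_mult_imp_div_less, (metis mod_less_divisor mult_is_0 not_less_zero neq0_conv)+)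
    finally show ?thesis ..
  qed
  have "sos_values k z = fst ` spectrahedron l (k * k) (\<lambda>_ _. 0) M L"
  proof (intro equalityI subsetI)
    fix y assume "y \<in> sos_values k z"
    then obtain G where G: "psd_matrix k G" "y = (\<Sum>i<k. \<Sum>j<k. G i j *\<^sub>R z i j)"
      unfolding sos_values_eq_psd_image by blast
    \<comment> \<open>A spectrahedron demands that the lifting variables vanish from index
      \<open>k * k\<close> on.\<close>
    define u where "u t = (if t < k * k then G (t div k) (t mod k) else 0)" for t
    have u: "u (i * k + j) = G i j" if "i < k" "j < k" for i j
      using that lt by (simp add: u_def)
    then have y: "y = zu u" unfolding zu G(2) by simp
    have "psd_matrix l (X y u) = psd_matrix l (\<lambda>i j. if i < k \<and> j < k then G i j else 0)"
      unfolding psd_matrix_def by (simp add: X y u cong: if_cong)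
    then have "psd_matrix l (X y u)"
      using psd_matrix_extend_zero[OF G(1), of l] by (simp add: l_def)
    then have "(y, u) \<in> spectrahedron l (k * k) (\<lambda>_ _. 0) M L"
      by (simp add: spectrahedron_def X_def[abs_def] u_def)
    then show "y \<in> fst ` spectrahedron l (k * k) (\<lambda>_ _. 0) M L" by force
  next
    fix y assume "y \<in> fst ` spectrahedron l (k * k) (\<lambda>_ _. 0) M L"
    then obtain u where psd: "psd_matrix l (X y u)"
      by (auto simp: spectrahedron_def X_def[abs_def])
    have "(y - zu u) \<bullet> b = 0" if "b \<in> Basis" for b
    proof -
      have "b \<in> set bs" using that bs(1) by simp
      then obtain t where t: "t < n" "bs ! t = b"
        unfolding in_set_conv_nth n_def by blast
      then have *: "k + t < l" "k + n + t < l" by (auto simp: l_def)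
      have "0 \<le> (y - zu u) \<bullet> b"
        using psd_matrix_diag_nonneg[OF psd *(1)] t unfolding X[OF *(1)] by (simp add: sgn_def e_def)
      moreover have "0 \<le> - ((y - zu u) \<bullet> b)"
        using psd_matrix_diag_nonneg[OF psd *(2)] t unfolding X[OF *(2)] by (simp add: sgn_def e_def)
      ultimately show ?thesis by linarith
    qed
    then have "y = zu u" by (metis euclidean_all_zero_iff eq_iff_diff_eq_0)
    moreover have "psd_matrix k (\<lambda>i j. u (i * k + j))"
      using psd_matrix_leading_block[OF psd, of k] X by (simp add: psd_matrix_def l_def)
    ultimately show "y \<in> sos_values k z"
      unfolding sos_values_eq_psd_image zu by (intro CollectI exI[of _ "\<lambda>i j. u (i * k + j)"]) simp
  qed
  then show ?thesis unfolding semidefinite_representable_def by blast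
qed

text \<open>Placing the two coefficient families in diagonal blocks removes all cross terms, so each
  vector contributes its two halves independently.\<close>

lemma sos_values_add:
  fixes z z' :: "nat \<Rightarrow> nat \<Rightarrow> 'v::real_vector"
  shows "{a + b | a b. a \<in> sos_values k z \<and> b \<in> sos_values k' z'} =
    sos_values (k + k') (\<lambda>i j. if i < k \<and> j < k then z i j
      else if k \<le> i \<and> k \<le> j then z' (i - k) (j - k) else 0)"
proof -
  define f where "f k z x = (\<Sum>i<k. \<Sum>j<k. (x i * x j) *\<^sub>R z i j)"
    for k and z :: "nat \<Rightarrow> nat \<Rightarrow> 'v::real_vector" and x :: "nat \<Rightarrow> real"
  define z'' where "z'' = (\<lambda>i j. if i < k \<and> j < k then z i j
      else if k \<le> i \<and> k \<le> j then z' (i - k) (j - k) else 0)"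
  have split: "sum g {..<k + k'} = sum g {..<k} + (\<Sum>i<k'. g (k + i))" for g :: "nat \<Rightarrow> 'v"
    by (induction k') (simp_all add: add.assoc)
  have f: "f (k + k') z'' x = f k z x + f k' z' (\<lambda>i. x (k + i))" for x
    by (simp add: f_def split z''_def)
  show ?thesis
    unfolding sos_values_def z''_def[symmetric] f_def[symmetric]
  proof (intro equalityI subsetI)
    fix y assume "y \<in> {a + b | a b. a \<in> {(\<Sum>x\<leftarrow>xs. f k z x) | xs. True} \<and> b \<in> {(\<Sum>x\<leftarrow>xs. f k' z' x) | xs. True}}"
    then obtain xs ys where y: "y = (\<Sum>x\<leftarrow>xs. f k z x) + (\<Sum>x\<leftarrow>ys. f k' z' x)" by blast
    \<comment> \<open>Each vector is supported on one block, so that it contributes to one of the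
      two sums only.\<close>
    define zs where "zs = map (\<lambda>x i. if i < k then x i else 0) xs @ map (\<lambda>x i. if i < k then 0 else x (i - k)) ys"
    have "y = (\<Sum>x\<leftarrow>zs. f (k + k') z'' x)"
    proof -
      have "f k z (\<lambda>i. if i < k then x i else 0) = f k z x"
        "f k z (\<lambda>i. if i < k then 0 else x (i - k)) = 0" "f k' z' (\<lambda>i. 0) = 0" for x
        by (simp_all add: f_def)
      then show ?thesis unfolding y zs_def f by (simp add: comp_def)
    qed
    then show "y \<in> {(\<Sum>x\<leftarrow>xs. f (k + k') z'' x) | xs. True}" by blast
  next
    fix y assume "y \<in> {(\<Sum>x\<leftarrow>xs. f (k + k') z'' x) | xs. True}"
    then obtain xs where y: "y = (\<Sum>x\<leftarrow>xs. f (k + k') z'' x)" by blast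
    have "y = (\<Sum>x\<leftarrow>xs. f k z x) + (\<Sum>x\<leftarrow>map (\<lambda>x i. x (k + i)) xs. f k' z' x)"
      unfolding y f by (simp add: sum_list_addf comp_def)
    then show "y \<in> {a + b | a b. a \<in> {(\<Sum>x\<leftarrow>xs. f k z x) | xs. True} \<and> b \<in> {(\<Sum>x\<leftarrow>xs. f k' z' x) | xs. True}}"
      by blast
  qed
qed

section \<open>Polynomials in the Fourier coefficients\<close>

lemma poly_mapping_sum_single:
  "(\<Sum>k\<in>Poly_Mapping.keys p. Poly_Mapping.single k (Poly_Mapping.lookup p k)) = p"
  by (rule poly_mapping_eqI) (auto simp: lookup_sum lookup_single when_def in_keys_iff)

lemma eval_fpoly_superset:
  assumes "finite S" "Poly_Mapping.keys p \<subseteq> S"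
  shows "eval_fpoly p c = (\<Sum>as\<in>S. Poly_Mapping.lookup p as * eval_monom c as)"
  unfolding eval_fpoly_def
  using assms by (intro sum.mono_neutral_left) (auto simp: in_keys_iff)

lemma eval_fpoly_add: "eval_fpoly (p + q) c = eval_fpoly p c + eval_fpoly q c"
proof -
  let ?S = "Poly_Mapping.keys p \<union> Poly_Mapping.keys q"
  have "eval_fpoly (p + q) c = (\<Sum>as\<in>?S. Poly_Mapping.lookup (p + q) as * eval_monom c as)"
    by (rule eval_fpoly_superset) (simp_all add: keys_add)
  also have "\<dots> = eval_fpoly p c + eval_fpoly q c"
    by (simp add: eval_fpoly_superset[of ?S] lookup_add distrib_right sum.distrib)
  finally show ?thesis .
qed

lemma eval_fpoly_zero [simp]: "eval_fpoly 0 c = 0"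
  by (simp add: eval_fpoly_def)

lemma eval_fpoly_single [simp]:
  "eval_fpoly (Poly_Mapping.single as t) c = t * eval_monom c as"
  by (subst eval_fpoly_superset[of "{as}"]) auto

lemma eval_monom_empty [simp]: "eval_monom c {#} = 1"
  and eval_monom_add_mset [simp]: "eval_monom c (add_mset a as) = coord c a * eval_monom c as"
  and eval_monom_plus: "eval_monom c (as + bs) = eval_monom c as * eval_monom c bs"
  by (simp_all add: eval_monom_def)

lemma eval_fpoly_one [simp]: "eval_fpoly 1 c = 1"
  by (simp flip: single_one add: zero_multiset_def[symmetric])

lemma eval_fpoly_diff: "eval_fpoly (p - q) c = eval_fpoly p c - eval_fpoly q c"
  using eval_fpoly_add[of "p - q" q c] by simp

lemma eval_fpoly_sum: "eval_fpoly (\<Sum>x\<in>X. f x) c = (\<Sum>x\<in>X. eval_fpoly (f x) c)"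
  by (induction X rule: infinite_finite_induct) (simp_all add: eval_fpoly_add)

lemma eval_fpoly_sum_list: "eval_fpoly (\<Sum>x\<leftarrow>xs. f x) c = (\<Sum>x\<leftarrow>xs. eval_fpoly (f x) c)"
  by (induction xs) (simp_all add: eval_fpoly_add)

lemma eval_fpoly_mult: "eval_fpoly (p * q) c = eval_fpoly p c * eval_fpoly q c"
proof -
  have "eval_fpoly (p * q) c =
    eval_fpoly ((\<Sum>as\<in>Poly_Mapping.keys p. Poly_Mapping.single as (Poly_Mapping.lookup p as)) *
      (\<Sum>bs\<in>Poly_Mapping.keys q. Poly_Mapping.single bs (Poly_Mapping.lookup q bs))) c"
    by (simp only: poly_mapping_sum_single)
  also have "\<dots> = eval_fpoly p c * eval_fpoly q c"
    unfolding sum_product eval_fpoly_sum mult_single eval_fpoly_single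
    unfolding eval_fpoly_def sum_product by (simp add: eval_monom_plus mult_ac)
  finally show ?thesis .
qed

text \<open>At a Hermitian sequence, negating the indices of a monomial conjugates its
  value.\<close>

lemma eval_fpoly_herm_conj:
  assumes "hermitian_seq c"
  shows "eval_fpoly (herm_conj q) c = cnj (eval_fpoly q c)"
proof -
  have "eval_monom c (image_mset uminus as) = cnj (eval_monom c as)" for as
    using assms by (induction as) (simp_all add: hermitian_seq_def)
  then show ?thesis
    by (simp add: herm_conj_def eval_fpoly_sum) (simp add: eval_fpoly_def)
qed

section \<open>Polynomials of bounded algebraic and harmonic degree\<close>

definition bounded_monoms :: "nat \<Rightarrow> nat \<Rightarrow> (int^'n::finite) multiset set"
  where "bounded_monoms r \<rho> = {as. size as \<le> r \<and> harmonic_degree as \<le> \<rho>}"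

text \<open>Both degree bounds together restrict the support to a finite set of monomials, hence the
  polynomials form a finite-dimensional space.\<close>

lemma bounded_polys_iff: "p \<in> bounded_polys r \<rho> \<longleftrightarrow> Poly_Mapping.keys p \<subseteq> bounded_monoms r \<rho>"
  by (auto simp: bounded_polys_def poly_alg_degree_def poly_harm_degree_def bounded_monoms_def)

lemma finite_vec_bounded:
  fixes S :: "'b set"
  assumes "finite S"
  shows "finite {a :: 'b^'n::finite. \<forall>i. a $ i \<in> S}"
proof (rule finite_subset)
  show "{a :: 'b^'n. \<forall>i. a $ i \<in> S} \<subseteq> vec_lambda ` (PiE UNIV (\<lambda>_. S))"
    by (auto intro!: image_eqI[of _ _ "vec_nth _"] simp: PiE_def extensional_def)
  show "finite (vec_lambda ` (PiE UNIV (\<lambda>_::'n. S)))"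
    using assms by (intro finite_imageI finite_PiE) auto
qed

lemma finite_index_degree_le: "finite {a :: int^'n::finite. index_degree a \<le> \<rho>}"
proof (rule finite_subset)
  show "{a :: int^'n. index_degree a \<le> \<rho>} \<subseteq> {a. \<forall>i. a $ i \<in> {- int \<rho>..int \<rho>}}"
  proof clarify
    fix a :: "int^'n" and i assume "index_degree a \<le> \<rho>"
    then have "nat \<bar>a $ i\<bar> \<le> \<rho>" by (simp add: index_degree_def)
    then show "a $ i \<in> {- int \<rho>..int \<rho>}" by auto
  qed
qed (intro finite_vec_bounded, simp)

lemma finite_bounded_monoms: "finite (bounded_monoms r \<rho> :: (int^'n::finite) multiset set)"
proof (rule finite_subset)
  show "bounded_monoms r \<rho> \<subseteq> (\<Union>n\<le>r. multisets_of_size {a :: int^'n. index_degree a \<le> \<rho>} n)"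
    by (auto simp: bounded_monoms_def harmonic_degree_def multisets_of_size_def)
qed (auto intro: finite_index_degree_le)

text \<open>Real and imaginary parts of the coefficients serve as separate real coordinates.\<close>

lemma bounded_polys_real_basis:
  "\<exists>k (u :: nat \<Rightarrow> 'n::finite fpoly).
    (\<forall>q\<in>bounded_polys r \<rho>. \<exists>x. \<forall>c. eval_fpoly q c = (\<Sum>i<k. complex_of_real (x i) * eval_fpoly (u i) c)) \<and>
    (\<forall>x. \<exists>q\<in>bounded_polys r \<rho>. \<forall>c. eval_fpoly q c = (\<Sum>i<k. complex_of_real (x i) * eval_fpoly (u i) c))"
proof -
  let ?B = "bounded_monoms r \<rho> :: (int^'n) multiset set"
  obtain ms where ms: "set ms = ?B" "distinct ms"
    using finite_distinct_list[OF finite_bounded_monoms] by blast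
  define n where "n = length ms"
  \<comment> \<open>Over the reals each monomial is needed twice: index i stands for the monomial
    itself, index n + i for the imaginary unit times the same monomial.\<close>
  define e where "e i = (if i < n then ms ! i else ms ! (i - n))" for i
  define s where "s i = (if i < n then 1 else \<i>)" for i
  define u where "u i = Poly_Mapping.single (e i) (s i)" for i
  show ?thesis
  proof (intro exI[of _ "n + n"] exI[of _ u] conjI ballI allI)
    fix q :: "'n fpoly" assume "q \<in> bounded_polys r \<rho>"
    then have q: "Poly_Mapping.keys q \<subseteq> ?B" by (simp add: bounded_polys_iff)
    define x where "x i = (if i < n then Re else Im) (Poly_Mapping.lookup q (e i))" for i
    have "eval_fpoly q c = (\<Sum>i<n + n. complex_of_real (x i) * eval_fpoly (u i) c)" for c
    proof -
      have "eval_fpoly q c = (\<Sum>as\<in>?B. Poly_Mapping.lookup q as * eval_monom c as)"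
        by (rule eval_fpoly_superset[OF finite_bounded_monoms q])
      also have "\<dots> = (\<Sum>i<n. Poly_Mapping.lookup q (ms ! i) * eval_monom c (ms ! i))"
        unfolding n_def using bij_betw_nth[OF ms(2) refl ms(1)[symmetric]]
        by (rule sum.reindex_bij_betw[symmetric])
      also have "\<dots> = (\<Sum>i<n. complex_of_real (x i) * eval_fpoly (u i) c
          + complex_of_real (x (n + i)) * eval_fpoly (u (n + i)) c)"
        by (intro sum.cong refl, subst (1) complex_eq)
          (simp add: x_def u_def e_def s_def algebra_simps)
      also have "\<dots> = (\<Sum>i<n + n. complex_of_real (x i) * eval_fpoly (u i) c)"
        unfolding sum.distrib by (simp add: lessThan_atLeast0 sum.atLeastLessThan_concat[symmetric, of 0 n "n + n"]
            sum.atLeastLessThan_shift_0[of _ n])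
      finally show ?thesis .
    qed
    then show "\<exists>x. \<forall>c. eval_fpoly q c = (\<Sum>i<n + n. complex_of_real (x i) * eval_fpoly (u i) c)"
      by blast
  next
    fix x :: "nat \<Rightarrow> real"
    define q where "q = (\<Sum>i<n + n. Poly_Mapping.single (e i) (complex_of_real (x i) * s i))"
    have "e i \<in> ?B" if "i < n + n" for i
      using that ms(1) by (auto simp: e_def n_def intro!: nth_mem)
    then have "q \<in> bounded_polys r \<rho>"
      unfolding bounded_polys_iff
      by (auto simp: q_def in_keys_iff lookup_sum lookup_single when_def elim!: sum.not_neutral_contains_not_neutral split: if_splits)
    moreover have "eval_fpoly q c = (\<Sum>i<n + n. complex_of_real (x i) * eval_fpoly (u i) c)" for c
      by (simp add: q_def u_def eval_fpoly_sum mult.assoc)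
    ultimately show "\<exists>q\<in>bounded_polys r \<rho>. \<forall>c. eval_fpoly q c
        = (\<Sum>i<n + n. complex_of_real (x i) * eval_fpoly (u i) c)" by blast
  qed
qed

section \<open>Continuity of polynomials on the sequence space\<close>

lemma coord_summable: "(\<lambda>a. (cmod (coord c a))\<^sup>2) summable_on UNIV"
  using coord[of c] by simp

lemma coord_diff_summable: "(\<lambda>a. (cmod (coord c a - coord d a))\<^sup>2) summable_on UNIV"
  by (intro summable_sq_diff coord_summable)

lemma dist_ell2_sq: "(dist c d)\<^sup>2 = (\<Sum>\<^sub>\<infinity>a. (cmod (coord c a - coord d a))\<^sup>2)"
  by (simp add: dist_ell2.rep_eq infsum_nonneg)

text \<open>One term of a nonnegative sum is at most the sum. Coordinates are thus 1-Lipschitz,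
  which makes all polynomials continuous.\<close>

lemma cmod_coord_diff_le: "cmod (coord c a - coord d a) \<le> dist c d"
proof (rule power2_le_imp_le)
  have "(\<Sum>b\<in>{a}. (cmod (coord c b - coord d b))\<^sup>2) \<le> (\<Sum>\<^sub>\<infinity>b. (cmod (coord c b - coord d b))\<^sup>2)"
    by (rule finite_sum_le_infsum) (auto intro: coord_diff_summable)
  then show "(cmod (coord c a - coord d a))\<^sup>2 \<le> (dist c d)\<^sup>2" by (simp add: dist_ell2_sq)
qed simp

lemma continuous_on_coord: "continuous_on S (\<lambda>c. coord c a)"
proof (rule continuous_on_subset)
  show "continuous_on UNIV (\<lambda>c. coord c a)"
    unfolding continuous_on_iff
    by (metis cmod_coord_diff_le dist_norm le_less_trans)
qed simp

lemma continuous_on_eval_monom: "continuous_on S (\<lambda>c. eval_monom c as)"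
  by (induction as) (auto intro!: continuous_intros continuous_on_coord)

lemma continuous_on_eval_fpoly: "continuous_on S (eval_fpoly p)"
  unfolding eval_fpoly_def[abs_def] by (intro continuous_intros continuous_on_eval_monom)

section \<open>The Sobolev ellipsoid in \<open>\<ell>\<^sub>2\<close>\<close>

lemma sobolev_weight_ge_1: "1 \<le> sobolev_weight m a"
  unfolding sobolev_weight_def by (intro one_le_power) simp

text \<open>For \<open>m \<ge> 1\<close> the weight dominates every |a_i|, because integers satisfy
  |t| \<le> t^2. Compactness of the ellipsoid rests on this growth.\<close>

lemma finite_sobolev_weight_le:
  assumes "m \<ge> 1"
  shows "finite {a :: int^'n::finite. sobolev_weight m a \<le> M}"
proof (rule finite_subset)
  show "{a :: int^'n. sobolev_weight m a \<le> M} \<subseteq> {a. \<forall>i. a $ i \<in> {- \<lceil>M\<rceil>..\<lceil>M\<rceil>}}"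
  proof clarify
    fix a :: "int^'n" and i assume M: "sobolev_weight m a \<le> M"
    have "\<bar>a $ i\<bar> \<le> (a $ i)\<^sup>2"
      using mult_left_mono[of 1 "\<bar>a $ i\<bar>" "\<bar>a $ i\<bar>"]
      by (cases "a $ i = 0") (auto simp: power2_eq_square)
    then have "real_of_int \<bar>a $ i\<bar> \<le> (real_of_int (a $ i))\<^sup>2"
      by (metis of_int_le_iff of_int_power)
    also have "\<dots> \<le> real_vec a \<bullet> real_vec a"
      unfolding inner_vec_def power2_eq_square
      by (simp add: member_le_sum[of i UNIV "\<lambda>i. real_of_int (a $ i) * real_of_int (a $ i)"])
    also have "\<dots> \<le> (1 + real_vec a \<bullet> real_vec a) ^ 1" by simp
    also have "\<dots> \<le> sobolev_weight m a"
      unfolding sobolev_weight_def by (rule power_increasing) (use assms in auto)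
    also have "\<dots> \<le> real_of_int \<lceil>M\<rceil>" using M by linarith
    finally show "a $ i \<in> {- \<lceil>M\<rceil>..\<lceil>M\<rceil>}" by (auto simp del: of_int_abs)
  qed
qed (intro finite_vec_bounded, simp)

text \<open>Bounding finite partial sums includes summability in the condition and presents the set
  as an intersection of closed conditions on finitely many coordinates each.\<close>

definition sobolev_ellipsoid :: "nat \<Rightarrow> (int^'n) ell2 set"
  where "sobolev_ellipsoid m = {c. \<forall>F. finite F \<longrightarrow> (\<Sum>a\<in>F. sobolev_weight m a * (cmod (coord c a))\<^sup>2) \<le> 1}"

lemma sum_bounded_imp_summable:
  fixes f :: "'a \<Rightarrow> real"
  assumes "\<And>a. 0 \<le> f a" "\<And>F. finite F \<Longrightarrow> sum f F \<le> C"
  shows "f summable_on UNIV" "infsum f UNIV \<le> C"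
proof -
  show *: "f summable_on UNIV"
    using assms by (intro nonneg_bdd_above_summable_on) (auto intro!: bdd_aboveI2[of _ _ C])
  show "infsum f UNIV \<le> C"
    by (rule infsum_le_finite_sums[OF *]) (use assms in auto)
qed

text \<open>Off a finite set of indices the weights are large, so on the ellipsoid coordinatewise
  convergence controls the distance.\<close>

lemma compact_sobolev_ellipsoid:
  assumes "m \<ge> 1"
  shows "compact (sobolev_ellipsoid m :: (int^'n::finite) ell2 set)"
proof -
  let ?w = "sobolev_weight m :: int^'n \<Rightarrow> real"
  \<comment> \<open>The same ellipsoid in the product topology, where Tychonoff's theorem makes it
    compact; it remains to see that \<open>Abs_ell2\<close> is continuous on it.\<close>
  define S where "S = {f :: int^'n \<Rightarrow> complex. \<forall>F. finite F \<longrightarrow> (\<Sum>a\<in>F. ?w a * (cmod (f a))\<^sup>2) \<le> 1}"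
  have S_le: "(\<Sum>a\<in>F. (cmod (f a))\<^sup>2) \<le> 1" if "f \<in> S" "finite F" for f F
  proof -
    have "(\<Sum>a\<in>F. (cmod (f a))\<^sup>2) \<le> (\<Sum>a\<in>F. ?w a * (cmod (f a))\<^sup>2)"
      using sobolev_weight_ge_1[of m] by (intro sum_mono) (auto simp: mult_le_cancel_right1)
    then show ?thesis using that unfolding S_def by force
  qed
  have S_ell2: "(\<lambda>a. (cmod (f a))\<^sup>2) summable_on UNIV" if "f \<in> S" for f
    using S_le[OF that] by (intro sum_bounded_imp_summable[of _ 1]) auto
  have coord_S: "coord (Abs_ell2 f) = f" if "f \<in> S" for f
    using S_ell2[OF that] by (simp add: Abs_ell2_inverse)
  have "closed S"
  proof -
    have "S = (\<Inter>F\<in>Collect finite. {f. (\<Sum>a\<in>F. ?w a * (cmod (f a))\<^sup>2) \<le> 1})"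
      by (auto simp: S_def)
    moreover have "closed \<dots>"
      by (intro closed_INT ballI closed_Collect_le continuous_intros continuous_on_product_coordinates)
    ultimately show ?thesis by simp
  qed
  moreover have "S \<subseteq> PiE UNIV (\<lambda>_. cball 0 1)"
  proof
    fix f assume f: "f \<in> S"
    have "cmod (f a) \<le> 1" for a
      using S_le[OF f, of "{a}"] by (simp add: power_le_one_iff abs_square_le_1[symmetric])
    then show "f \<in> PiE UNIV (\<lambda>_. cball 0 1)" by auto
  qed
  moreover have "compact (PiE UNIV (\<lambda>_. cball 0 1) :: (int^'n \<Rightarrow> complex) set)"
    using compactin_PiE[of "\<lambda>_. euclidean" UNIV "\<lambda>_::int^'n. cball (0::complex) 1"]
    by (simp add: euclidean_product_topology)
  ultimately have "compact S"
    by (metis compact_Int_closed inf.absorb_iff2)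
  moreover have "continuous_on S Abs_ell2"
  proof -
    have "((\<lambda>g. dist (Abs_ell2 g) (Abs_ell2 f)) \<longlongrightarrow> 0) (at f within S)" if f: "f \<in> S" for f
    proof (rule tendstoI)
      fix \<epsilon> :: real assume "\<epsilon> > 0"
      \<comment> \<open>Off F the squared differences add up to at most (2 + 2) / M, which this M
        turns into half of \<epsilon>^2; the other half is left for the finitely many indices in
        F.\<close>
      define M where "M = 8 / \<epsilon>\<^sup>2"
      have "M > 0" using \<open>\<epsilon> > 0\<close> by (simp add: M_def)
      define F where "F = {a. ?w a \<le> M}"
      have F: "finite F" unfolding F_def by (rule finite_sobolev_weight_le[OF assms])
      have tail: "(cmod (g a - f a))\<^sup>2 \<le> (2 * (?w a * (cmod (g a))\<^sup>2) + 2 * (?w a * (cmod (f a))\<^sup>2)) / M"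
        if "a \<notin> F" for g a
      proof -
        have "M * (cmod (g a - f a))\<^sup>2 \<le> ?w a * (2 * (cmod (g a))\<^sup>2 + 2 * (cmod (f a))\<^sup>2)"
          using that \<open>M > 0\<close> norm_add_sq_le[of 1 "g a" "- f a"] by (intro mult_mono) (auto simp: F_def)
        then show ?thesis using \<open>M > 0\<close> by (simp add: field_simps)
      qed
      have dist_le: "(dist (Abs_ell2 g) (Abs_ell2 f))\<^sup>2 \<le> (\<Sum>a\<in>F. (cmod (g a - f a))\<^sup>2) + \<epsilon>\<^sup>2 / 2" if g: "g \<in> S" for g
        unfolding dist_ell2_sq coord_S[OF f] coord_S[OF g]
      proof (rule sum_bounded_imp_summable(2))
        fix G :: "(int^'n) set" assume G: "finite G"
        have "(\<Sum>a\<in>G. (cmod (g a - f a))\<^sup>2) \<le> (\<Sum>a\<in>F \<union> G. (cmod (g a - f a))\<^sup>2)"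
          using F G by (intro sum_mono2) auto
        also have "\<dots> = (\<Sum>a\<in>F. (cmod (g a - f a))\<^sup>2) + (\<Sum>a\<in>G - F. (cmod (g a - f a))\<^sup>2)"
          using F G by (subst sum.union_disjoint[symmetric]) auto
        also have "(\<Sum>a\<in>G - F. (cmod (g a - f a))\<^sup>2)
          \<le> (\<Sum>a\<in>G - F. (2 * (?w a * (cmod (g a))\<^sup>2) + 2 * (?w a * (cmod (f a))\<^sup>2)) / M)"
          by (intro sum_mono tail) auto
        also have "\<dots> = (2 * (\<Sum>a\<in>G - F. ?w a * (cmod (g a))\<^sup>2) + 2 * (\<Sum>a\<in>G - F. ?w a * (cmod (f a))\<^sup>2)) / M"
          by (simp add: sum.distrib sum_distrib_left flip: sum_divide_distrib)
        also have "\<dots> \<le> (2 * 1 + 2 * 1) / M"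
          using f g G \<open>M > 0\<close> unfolding S_def by (intro divide_right_mono add_mono mult_left_mono) auto
        also have "\<dots> = \<epsilon>\<^sup>2 / 2" using \<open>\<epsilon> > 0\<close> by (simp add: M_def)
        finally show "(\<Sum>a\<in>G. (cmod (g a - f a))\<^sup>2) \<le> (\<Sum>a\<in>F. (cmod (g a - f a))\<^sup>2) + \<epsilon>\<^sup>2 / 2" by simp
      qed simp
      have "((\<lambda>g. \<Sum>a\<in>F. (cmod (g a - f a))\<^sup>2) \<longlongrightarrow> (\<Sum>a\<in>F. (cmod (f a - f a))\<^sup>2)) (at f within S)"
      proof -
        have "continuous_on S (\<lambda>g. \<Sum>a\<in>F. (cmod (g a - f a))\<^sup>2)"
          by (intro continuous_intros continuous_on_subset[OF continuous_on_product_coordinates]) simp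
        then show ?thesis using f unfolding continuous_on_def by blast
      qed
      then have "\<forall>\<^sub>F g in at f within S. (\<Sum>a\<in>F. (cmod (g a - f a))\<^sup>2) < \<epsilon>\<^sup>2 / 2"
        using \<open>\<epsilon> > 0\<close> by (intro order_tendstoD(2)[of _ 0]) auto
      moreover have "\<forall>\<^sub>F g in at f within S. g \<in> S" by (simp add: eventually_at_filter)
      ultimately show "\<forall>\<^sub>F g in at f within S. dist (dist (Abs_ell2 g) (Abs_ell2 f)) 0 < \<epsilon>"
      proof eventually_elim
        case (elim g)
        then have "(dist (Abs_ell2 g) (Abs_ell2 f))\<^sup>2 < \<epsilon>\<^sup>2" using dist_le[of g] by simp
        then show ?case using \<open>\<epsilon> > 0\<close> by (simp add: power_less_imp_less_base)
      qed
    qed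
    then show ?thesis unfolding continuous_on_def by (blast intro: tendsto_dist_iff[THEN iffD2])
  qed
  ultimately have "compact (Abs_ell2 ` S)" by (intro compact_continuous_image)
  moreover have "Abs_ell2 ` S = sobolev_ellipsoid m"
  proof (intro equalityI subsetI)
    fix c :: "(int^'n) ell2" assume "c \<in> sobolev_ellipsoid m"
    then have "coord c \<in> S" by (simp add: sobolev_ellipsoid_def S_def)
    then show "c \<in> Abs_ell2 ` S" by (metis coord_inverse imageI)
  qed (auto simp: sobolev_ellipsoid_def coord_S, auto simp: S_def)
  ultimately show ?thesis by simp
qed

section \<open>Orthonormality and Bessel's inequality\<close>

lemma integral_exp_2pi_interval:
  "(\<integral>t. indicator {0..1} t *\<^sub>R exp (- 2 * complex_of_real pi * \<i> * complex_of_real (of_int k * t)) \<partial>lborel)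
    = (if k = 0 then 1 else 0)"
proof (cases "k = 0")
  case False
  define d where "d = - 2 * complex_of_real pi * \<i> * of_int k"
  have "d \<noteq> 0" using False by (simp add: d_def)
  have "(\<integral>t. indicator {0..1} t *\<^sub>R exp (d * complex_of_real t) \<partial>lborel)
      = exp (d * complex_of_real 1) / d - exp (d * complex_of_real 0) / d"
  proof (rule integral_FTC_Icc)
    fix t :: real assume "0 \<le> t" "t \<le> 1"
    have "((\<lambda>z. exp (d * z) / d) has_field_derivative exp (d * complex_of_real t)) (at (complex_of_real t))"
      using \<open>d \<noteq> 0\<close> by (auto intro!: derivative_eq_intros)
    from has_vector_derivative_real_field[OF this]
    show "((\<lambda>t. exp (d * complex_of_real t) / d) has_vector_derivative exp (d * complex_of_real t)) (at t within {0..1})" .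
  qed (auto intro!: continuous_intros)
  also have "exp (d * complex_of_real 1) = 1"
    using exp_integer_2pi[of "of_int (- k)"] by (simp add: d_def mult_ac)
  finally show ?thesis using False by (simp add: d_def mult_ac)
qed simp

text \<open>Passes from the completed measure to \<open>lborel\<close>, which is an image of a
  product measure.\<close>

lemma integral_unit_cube_continuous:
  fixes f :: "real^'n::finite \<Rightarrow> complex"
  assumes "continuous_on UNIV f"
  shows "(LINT x|unit_cube. f x) = (\<integral>x. indicator (cbox 0 1) x *\<^sub>R f x \<partial>lborel)"
proof -
  have [measurable]: "f \<in> borel_measurable borel"
    using assms by (rule borel_measurable_continuous_onI)
  have "(LINT x|unit_cube. f x) = (\<integral>x. indicator (cbox 0 1) x *\<^sub>R f x \<partial>lebesgue)"
    by (subst integral_restrict_space) auto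
  also have "\<dots> = (\<integral>x. indicator (cbox 0 1) x *\<^sub>R f x \<partial>lborel)"
    by (rule integral_completion) simp
  finally show ?thesis .
qed

lemma continuous_on_fourier_basis: "continuous_on S (fourier_basis a)"
  unfolding fourier_basis_def[abs_def] by (intro continuous_intros)

text \<open>The exponential and the indicator of the cube both factor over the coordinates, so the
  integral is a product of one-dimensional ones.\<close>

lemma integral_fourier_basis:
  fixes a :: "int^'n::finite"
  shows "(LINT x|unit_cube. fourier_basis a x) = (if a = 0 then 1 else 0)"
proof -
  let ?e = "\<lambda>s. - 2 * complex_of_real pi * \<i> * complex_of_real s"
  interpret product_sigma_finite "\<lambda>_ :: real^'n. lborel :: real measure" ..
  \<comment> \<open>The inner products with basis vectors are integers already; the floor only
    changes their type.\<close>
  define k where "k b = \<lfloor>real_vec a \<bullet> b\<rfloor>" for b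
  have k: "real_vec a \<bullet> b = of_int (k b)" if "b \<in> Basis" for b
    using that by (auto simp: k_def Basis_vec_def inner_axis)
  have "(LINT x|unit_cube. fourier_basis a x)
    = (\<integral>x. indicator (cbox 0 1) x *\<^sub>R fourier_basis a x \<partial>lborel)"
    by (rule integral_unit_cube_continuous[OF continuous_on_fourier_basis])
  also have "\<dots> = (\<integral>f. indicator (cbox 0 1) (\<Sum>b\<in>Basis. f b *\<^sub>R b :: real^'n)
      *\<^sub>R fourier_basis a (\<Sum>b\<in>Basis. f b *\<^sub>R b) \<partial>(\<Pi>\<^sub>M b\<in>Basis. lborel))"
  proof -
    have [measurable]: "fourier_basis a \<in> borel_measurable borel"
      by (rule borel_measurable_continuous_onI[OF continuous_on_fourier_basis])
    show ?thesis by (subst lborel_eq, subst integral_distr) (measurable, auto)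
  qed
  also have "\<dots> = (\<integral>f. (\<Prod>b\<in>Basis. indicator {0..1} (f b) *\<^sub>R exp (?e (of_int (k b) * f b)))
      \<partial>(\<Pi>\<^sub>M b\<in>(Basis :: (real^'n) set). lborel))"
  proof (rule Bochner_Integration.integral_cong[OF refl])
    fix f :: "real^'n \<Rightarrow> real"
    let ?x = "\<Sum>b\<in>Basis. f b *\<^sub>R b"
    have one: "(1 :: real^'n) \<bullet> b = 1" if "b \<in> Basis" for b
      using that by (auto simp: Basis_vec_def inner_axis)
    have x: "?x \<bullet> b = f b" if "b \<in> Basis" for b using that by simp
    have "?x \<in> cbox 0 1 \<longleftrightarrow> (\<forall>b\<in>Basis. f b \<in> {0..1})"
      unfolding mem_box by (simp add: x one)
    then have ind: "indicator (cbox 0 1) ?x = (\<Prod>b\<in>Basis. indicator {0..1} (f b) :: real)"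
      by (auto simp: indicator_def prod_zero_iff intro!: prod.neutral split: if_splits)
    have "real_vec a \<bullet> ?x = (\<Sum>b\<in>Basis. of_int (k b) * f b)"
      by (simp add: inner_sum_right k mult.commute)
    then have e: "fourier_basis a ?x = (\<Prod>b\<in>Basis. exp (?e (of_int (k b) * f b)))"
      by (simp add: fourier_basis_def sum_distrib_left flip: exp_sum)
    show "indicator (cbox 0 1) ?x *\<^sub>R fourier_basis a ?x
      = (\<Prod>b\<in>Basis. indicator {0..1} (f b) *\<^sub>R exp (?e (of_int (k b) * f b)))"
      unfolding ind e by (simp add: scaleR_conv_of_real prod.distrib)
  qed
  also have "\<dots> = (\<Prod>b\<in>Basis. \<integral>t. indicator {0..1} t *\<^sub>R exp (?e (of_int (k b) * t)) \<partial>lborel)"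
  proof (rule product_integral_prod)
    fix b :: "real^'n"
    have "continuous_on {0..1::real} (\<lambda>t. exp (?e (of_int (k b) * t)))"
      by (intro continuous_intros)
    from borel_integrable_compact[OF compact_Icc this]
    show "integrable lborel (\<lambda>t. indicator {0..1} t *\<^sub>R exp (?e (of_int (k b) * t)))"
      by (simp add: indicator_scaleR_eq_if)
  qed simp
  also have "\<dots> = (\<Prod>b\<in>(Basis :: (real^'n) set). if k b = 0 then 1 else 0)"
    by (simp only: integral_exp_2pi_interval)
  also have "\<dots> = (if \<forall>b\<in>(Basis :: (real^'n) set). k b = 0 then 1 else 0)"
    by (auto simp: prod_zero_iff)
  also have "(\<forall>b\<in>(Basis :: (real^'n) set). k b = 0) \<longleftrightarrow> a = 0"
    by (auto simp: k_def Basis_vec_def inner_axis vec_eq_iff)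
  finally show ?thesis .
qed

lemma fourier_basis_diff: "fourier_basis (a - b) x = fourier_basis a x * cnj (fourier_basis b x)"
proof -
  have "real_vec (a - b) = real_vec a - real_vec b" by (simp add: vec_eq_iff)
  then show ?thesis
    unfolding fourier_basis_def by (simp only: inner_diff_left) (simp add: exp_cnj algebra_simps flip: exp_add)
qed

lemma cmod_fourier_basis [simp]: "cmod (fourier_basis a x) = 1"
  by (simp add: fourier_basis_def norm_exp_eq_Re)

lemma fourier_basis_periodic: "fourier_basis a (x + real_vec k) = fourier_basis a x"
proof -
  define l where "l = (\<Sum>i\<in>UNIV. a $ i * k $ i)"
  have l: "real_vec a \<bullet> real_vec k = of_int l"
    by (simp add: inner_vec_def l_def)
  have "exp (2 * complex_of_real pi * \<i> * of_int (- l)) = 1"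
    using exp_integer_2pi[of "of_int (- l)"] by (simp add: mult_ac)
  moreover have "fourier_basis a (x + real_vec k)
    = fourier_basis a x * exp (2 * complex_of_real pi * \<i> * of_int (- l))"
    unfolding fourier_basis_def inner_add_right l by (simp add: algebra_simps flip: exp_add)
  ultimately show ?thesis by simp
qed

lemma finite_measure_unit_cube: "finite_measure (unit_cube :: (real^'n::finite) measure)"
  by (intro finite_measure_lebesgue_on lmeasurable_cbox)

lemma measure_unit_cube: "measure unit_cube (cbox (0 :: real^'n::finite) 1) = 1"
proof -
  have "(0 :: real^'n) \<in> cbox 0 1" by (simp add: mem_box_cart)
  then have ne: "cbox (0 :: real^'n) 1 \<noteq> {}" by blast
  show ?thesis by (simp add: measure_restrict_space content_cbox_cart[OF ne])
qed

lemma has_bochner_integral_fourier_basis: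
  "has_bochner_integral unit_cube (fourier_basis (a :: int^'n::finite)) (if a = 0 then 1 else 0)"
proof -
  interpret finite_measure "unit_cube :: (real^'n) measure" by (rule finite_measure_unit_cube)
  have "integrable unit_cube (fourier_basis a)"
    by (rule integrable_const_bound[of _ 1]) auto
  then show ?thesis unfolding integral_fourier_basis[symmetric] by (rule has_bochner_integral_integrable)
qed

lemma torus_L2_integrable_sq: "f \<in> torus_L2 \<Longrightarrow> integrable unit_cube (\<lambda>x. (cmod (f x))\<^sup>2)"
  by (simp add: torus_L2_def)

text \<open>The bound |f| \<le> 1 + |f|^2 and the finite measure of the cube place square integrable
  functions in L^1.\<close>

lemma torus_L2_integrable_bounded:
  assumes f: "f \<in> torus_L2" and [measurable]: "g \<in> borel_measurable unit_cube" and g: "\<And>x. cmod (g x) \<le> 1"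
  shows "integrable unit_cube (\<lambda>x. f x * g x)"
proof (rule Bochner_Integration.integrable_bound)
  interpret finite_measure unit_cube by (rule finite_measure_unit_cube)
  show "integrable unit_cube (\<lambda>x. 1 + (cmod (f x))\<^sup>2)"
    using torus_L2_integrable_sq[OF f] by simp
  show "(\<lambda>x. f x * g x) \<in> borel_measurable unit_cube"
    using f by measurable
  have "cmod (f x * g x) \<le> 1 + (cmod (f x))\<^sup>2" for x
  proof -
    have "cmod (f x * g x) \<le> cmod (f x)" using g[of x] by (simp add: norm_mult mult_left_le)
    also have "\<dots> \<le> 1 + (cmod (f x))\<^sup>2"
    proof -
      have "0 \<le> (cmod (f x) - 1)\<^sup>2" by simp
      then have "2 * cmod (f x) \<le> 1 + (cmod (f x))\<^sup>2" by (simp add: power2_diff)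
      then show ?thesis using norm_ge_zero[of "f x"] by linarith
    qed
    finally show ?thesis .
  qed
  then show "AE x in unit_cube. cmod (f x * g x) \<le> norm (1 + (cmod (f x))\<^sup>2)"
    by (simp add: abs_of_nonneg)
qed

lemma torus_L2_zero [simp]: "(\<lambda>_. 0) \<in> torus_L2"
  by (simp add: torus_L2_def)

lemma torus_L2_diff:
  assumes "f \<in> torus_L2" "g \<in> torus_L2"
  shows "(\<lambda>x. f x - g x) \<in> torus_L2"
  using assms torus_L2_integrable_diff[OF assms] by (auto simp: torus_L2_def intro: borel_measurable_diff)

lemma trig_poly_torus_L2:
  fixes F :: "(int^'n::finite) set"
  shows "(\<lambda>x. \<Sum>a\<in>F. c a * cnj (fourier_basis a x)) \<in> torus_L2"
proof -
  interpret finite_measure "unit_cube :: (real^'n) measure" by (rule finite_measure_unit_cube)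
  let ?p = "\<lambda>x. \<Sum>a\<in>F. c a * cnj (fourier_basis a x)"
  have "continuous_on UNIV ?p"
    by (intro continuous_intros continuous_on_fourier_basis)
  then have "?p \<in> borel_measurable borel" by (rule borel_measurable_continuous_onI)
  then have m: "?p \<in> borel_measurable lebesgue" by (simp add: measurable_completion)
  then have [measurable]: "?p \<in> borel_measurable unit_cube" by (rule measurable_restrict_space1)
  have "cmod (?p x) \<le> (\<Sum>a\<in>F. cmod (c a))" for x
    by (rule sum_norm_le) (simp add: norm_mult)
  then have "integrable unit_cube (\<lambda>x. (cmod (?p x))\<^sup>2)"
    by (intro integrable_const_bound[of _ "(\<Sum>a\<in>F. cmod (c a))\<^sup>2"]) (auto intro!: power_mono)
  with m show ?thesis by (simp add: torus_L2_def fourier_basis_periodic)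
qed

text \<open>The square is expanded and integrated term by term, and orthonormality leaves only the
  diagonal of the last double sum. Special choices of \<open>f\<close> and \<open>c\<close> give
  Bessel's inequality, Parseval's identity for trigonometric polynomials and the continuity of the
  coefficients.\<close>

lemma integral_sq_diff_trig_poly:
  fixes f :: "real^'n::finite \<Rightarrow> complex"
  assumes f: "f \<in> torus_L2" and "finite F"
  shows "(LINT x|unit_cube. (cmod (f x - (\<Sum>a\<in>F. c a * cnj (fourier_basis a x))))\<^sup>2)
    = (LINT x|unit_cube. (cmod (f x))\<^sup>2)
      - 2 * (\<Sum>a\<in>F. Re (cnj (c a) * (LINT x|unit_cube. f x * fourier_basis a x)))
      + (\<Sum>a\<in>F. (cmod (c a))\<^sup>2)"
proof -
  let ?M = "unit_cube"
  have 1: "has_bochner_integral ?M (\<lambda>x. (cmod (f x))\<^sup>2) (LINT x|?M. (cmod (f x))\<^sup>2)"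
    by (intro has_bochner_integral_integrable torus_L2_integrable_sq f)
  have 2: "has_bochner_integral ?M (\<lambda>x. \<Sum>a\<in>F. Re (cnj (c a) * (f x * fourier_basis a x)))
      (\<Sum>a\<in>F. Re (cnj (c a) * (LINT x|?M. f x * fourier_basis a x)))"
    by (intro has_bochner_integral_sum has_bochner_integral_Re has_bochner_integral_mult_right
      has_bochner_integral_integrable torus_L2_integrable_bounded f fourier_basis_measurable) simp
  have 3: "has_bochner_integral ?M (\<lambda>x. \<Sum>a\<in>F. \<Sum>b\<in>F. Re (c a * cnj (c b) * fourier_basis (b - a) x))
      (\<Sum>a\<in>F. \<Sum>b\<in>F. Re (c a * cnj (c b) * (if b - a = 0 then 1 else 0)))"
    by (intro has_bochner_integral_sum has_bochner_integral_Re has_bochner_integral_mult_right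
      has_bochner_integral_fourier_basis)
  have expand: "(cmod (f x - (\<Sum>a\<in>F. c a * cnj (fourier_basis a x))))\<^sup>2
    = (cmod (f x))\<^sup>2 - 2 * (\<Sum>a\<in>F. Re (cnj (c a) * (f x * fourier_basis a x)))
      + (\<Sum>a\<in>F. \<Sum>b\<in>F. Re (c a * cnj (c b) * fourier_basis (b - a) x))" for x
  proof -
    define S where "S = (\<Sum>a\<in>F. c a * cnj (fourier_basis a x))"
    have "(\<Sum>a\<in>F. Re (cnj (c a) * (f x * fourier_basis a x))) = Re (f x * cnj S)"
      by (simp add: S_def sum_distrib_left mult_ac del: times_complex.simps flip: Re_sum)
    moreover have "(\<Sum>a\<in>F. \<Sum>b\<in>F. Re (c a * cnj (c b) * fourier_basis (b - a) x)) = Re (S * cnj S)"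
      by (simp add: S_def sum_product fourier_basis_diff mult_ac del: times_complex.simps flip: Re_sum)
    moreover have "(cmod (f x - S))\<^sup>2 = (cmod (f x))\<^sup>2 - 2 * Re (f x * cnj S) + Re (S * cnj S)"
      unfolding cmod_power2 by (simp add: power2_eq_square algebra_simps)
    ultimately show ?thesis by (simp add: S_def)
  qed
  have "(\<Sum>a\<in>F. \<Sum>b\<in>F. Re (c a * cnj (c b) * (if b - a = 0 then 1 else 0))) = (\<Sum>a\<in>F. (cmod (c a))\<^sup>2)"
  proof (rule sum.cong[OF refl])
    fix a assume "a \<in> F"
    have "(\<Sum>b\<in>F. Re (c a * cnj (c b) * (if b - a = 0 then 1 else 0)))
      = (\<Sum>b\<in>F. if b = a then (cmod (c a))\<^sup>2 else 0)"
      by (intro sum.cong) (auto simp: cmod_power2 simp flip: power2_eq_square)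
    then show "(\<Sum>b\<in>F. Re (c a * cnj (c b) * (if b - a = 0 then 1 else 0))) = (cmod (c a))\<^sup>2"
      using \<open>finite F\<close> \<open>a \<in> F\<close> by simp
  qed
  then show ?thesis
    unfolding expand
    using has_bochner_integral_add[OF has_bochner_integral_diff[OF 1 has_bochner_integral_mult_right[OF 2, of 2]] 3]
    by (simp add: has_bochner_integral_integral_eq)
qed

text \<open>The conjugate undoes the minus sign in \<open>fourier_basis\<close>, so that
  \<open>c\<close> becomes the family of Fourier coefficients.\<close>

lift_definition trig_poly :: "(int^'n) set \<Rightarrow> (int^'n \<Rightarrow> complex) \<Rightarrow> 'n::finite L2_torus"
  is "\<lambda>F c x. \<Sum>a\<in>F. c a * cnj (fourier_basis a x)"
  by (simp add: torus_L2_eq_def trig_poly_torus_L2)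

text \<open>\<open>L2_torus\<close> carries a metric but no norm, so the norm of \<open>f\<close> is
  written as its distance from the empty trigonometric polynomial.\<close>

lemma dist_trig_poly_sq:
  fixes f :: "'n::finite L2_torus"
  assumes "finite F"
  shows "(dist f (trig_poly F c))\<^sup>2 = (dist f (trig_poly {} (\<lambda>_. 0)))\<^sup>2
    - 2 * (\<Sum>a\<in>F. Re (cnj (c a) * fourier_coeff f a)) + (\<Sum>a\<in>F. (cmod (c a))\<^sup>2)"
  using assms
proof transfer
  fix f :: "real^'n \<Rightarrow> complex" and c and F :: "(int^'n) set"
  assume "torus_L2_eq f f" and F: "finite F"
  then have f: "f \<in> torus_L2" by (simp add: torus_L2_eq_def)
  have nonneg: "0 \<le> (LINT x|unit_cube. (cmod (h x))\<^sup>2)" for h :: "real^'n \<Rightarrow> complex"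
    by simp
  show "(sqrt (LINT x|unit_cube. (cmod (f x - (\<Sum>a\<in>F. c a * cnj (fourier_basis a x))))\<^sup>2))\<^sup>2 =
       (sqrt (LINT x|unit_cube. (cmod (f x - (\<Sum>a\<in>{}. 0 * cnj (fourier_basis a x))))\<^sup>2))\<^sup>2 -
       2 * (\<Sum>a\<in>F. Re (cnj (c a) * (LINT x|unit_cube. f x * fourier_basis a x))) +
       (\<Sum>a\<in>F. (cmod (c a))\<^sup>2)"
    unfolding real_sqrt_pow2[OF nonneg] using integral_sq_diff_trig_poly[OF f F, of c] by simp
qed

text \<open>The squared distance of \<open>f\<close> from its own partial sum is
  nonnegative.\<close>

lemma bessel_inequality:
  assumes "finite F"
  shows "(\<Sum>a\<in>F. (cmod (fourier_coeff f a))\<^sup>2) \<le> (dist f (trig_poly {} (\<lambda>_. 0)))\<^sup>2"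
proof -
  have "Re (cnj z * z) = (cmod z)\<^sup>2" for z by (simp add: cmod_power2 flip: power2_eq_square)
  then have "0 \<le> (dist f (trig_poly {} (\<lambda>_. 0)))\<^sup>2 - (\<Sum>a\<in>F. (cmod (fourier_coeff f a))\<^sup>2)"
    using dist_trig_poly_sq[OF assms, of f "fourier_coeff f"]
      zero_le_power2[of "dist f (trig_poly F (fourier_coeff f))"] by simp
  then show ?thesis by simp
qed

lemma fourier_coeff_summable: "(\<lambda>a. (cmod (fourier_coeff f a))\<^sup>2) summable_on UNIV"
  using bessel_inequality[of _ f] by (intro sum_bounded_imp_summable(1)) auto

text \<open>By Bessel's inequality \<open>fourier_map\<close> applies \<open>Abs_ell2\<close> inside
  the carrier of the type, so nothing is lost.\<close>

lemma coord_fourier_map [simp]: "coord (fourier_map f) = fourier_coeff f"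
  using fourier_coeff_summable[of f] by (simp add: fourier_map_def Abs_ell2_inverse)

lemma fourier_coeff_trig_poly:
  assumes "finite F"
  shows "fourier_coeff (trig_poly F c) a = (if a \<in> F then c a else 0)"
  using assms
proof transfer
  fix F :: "(int^'a) set" and c a assume "finite F"
  have *: "has_bochner_integral unit_cube (\<lambda>x. \<Sum>b\<in>F. c b * fourier_basis (a - b) x)
    (\<Sum>b\<in>F. c b * (if a - b = 0 then 1 else 0))"
    by (intro has_bochner_integral_sum has_bochner_integral_mult_right has_bochner_integral_fourier_basis)
  have "(\<Sum>b\<in>F. c b * (if a - b = 0 then 1 else 0)) = (\<Sum>b\<in>F. if b = a then c a else 0)"
    by (intro sum.cong) auto
  moreover have "(\<Sum>b\<in>F. c b * cnj (fourier_basis b x)) * fourier_basis a x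
    = (\<Sum>b\<in>F. c b * fourier_basis (a - b) x)" for x
    by (simp add: fourier_basis_diff sum_distrib_left mult_ac)
  ultimately show "(LINT x|unit_cube. (\<Sum>b\<in>F. c b * cnj (fourier_basis b x)) * fourier_basis a x)
    = (if a \<in> F then c a else 0)"
    using \<open>finite F\<close> has_bochner_integral_integral_eq[OF *] by simp
qed

text \<open>The expansion formula for the zero function and the coefficients
  \<open>d a - c a\<close>.\<close>

lemma dist_trig_poly:
  assumes "finite F"
  shows "(dist (trig_poly F c) (trig_poly F d))\<^sup>2 = (\<Sum>a\<in>F. (cmod (c a - d a))\<^sup>2)"
  using assms
proof transfer
  fix F :: "(int^'a) set" and c d :: "int^'a \<Rightarrow> complex" assume F: "finite F"
  have "(LINT x|unit_cube. (cmod ((\<Sum>a\<in>F. c a * cnj (fourier_basis a x)) - (\<Sum>a\<in>F. d a * cnj (fourier_basis a x))))\<^sup>2)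
    = (LINT x|unit_cube. (cmod (0 - (\<Sum>a\<in>F. (d a - c a) * cnj (fourier_basis a x))))\<^sup>2)"
    by (simp add: sum_subtractf algebra_simps)
  also have "\<dots> = (\<Sum>a\<in>F. (cmod (c a - d a))\<^sup>2)"
    by (subst integral_sq_diff_trig_poly[OF torus_L2_zero F]) (simp add: norm_minus_commute)
  finally show "(sqrt (LINT x|unit_cube. (cmod ((\<Sum>a\<in>F. c a * cnj (fourier_basis a x))
      - (\<Sum>a\<in>F. d a * cnj (fourier_basis a x))))\<^sup>2))\<^sup>2 = (\<Sum>a\<in>F. (cmod (c a - d a))\<^sup>2)"
    by (simp add: sum_nonneg)
qed

text \<open>Bessel's inequality for one index, applied to the difference of two
  representatives.\<close>

lemma cmod_fourier_coeff_diff_le: "cmod (fourier_coeff f a - fourier_coeff g a) \<le> dist f g"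
proof transfer
  fix f g :: "real^'a \<Rightarrow> complex" and a :: "int^'a"
  assume "torus_L2_eq f f" "torus_L2_eq g g"
  then have fg: "f \<in> torus_L2" "g \<in> torus_L2" by (auto simp: torus_L2_eq_def)
  define h where "h x = f x - g x" for x
  define z where "z = (LINT x|unit_cube. h x * fourier_basis a x)"
  have z: "z = (LINT x|unit_cube. f x * fourier_basis a x) - (LINT x|unit_cube. g x * fourier_basis a x)"
    unfolding z_def h_def left_diff_distrib
    by (intro Bochner_Integration.integral_diff torus_L2_integrable_bounded fg) auto
  have "h \<in> torus_L2" unfolding h_def by (rule torus_L2_diff[OF fg])
  from integral_sq_diff_trig_poly[OF this, of "{a}" "\<lambda>_. z"]
  have "(cmod z)\<^sup>2 \<le> (LINT x|unit_cube. (cmod (h x))\<^sup>2)"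
  proof -
    have "0 \<le> (LINT x|unit_cube. (cmod (h x - (\<Sum>a\<in>{a}. z * cnj (fourier_basis a x))))\<^sup>2)" by simp
    also have "\<dots> = (LINT x|unit_cube. (cmod (h x))\<^sup>2) - (cmod z)\<^sup>2"
      by (subst integral_sq_diff_trig_poly[OF \<open>h \<in> torus_L2\<close>])
        (simp_all add: z_def[symmetric] cmod_power2 flip: power2_eq_square)
    finally show ?thesis by simp
  qed
  then show "cmod ((LINT x|unit_cube. f x * fourier_basis a x) - (LINT x|unit_cube. g x * fourier_basis a x))
    \<le> sqrt (LINT x|unit_cube. (cmod (f x - g x))\<^sup>2)"
    unfolding z[symmetric] h_def by (rule real_le_rsqrt)
qed

lemma continuous_on_fourier_coeff: "continuous_on S (\<lambda>f. fourier_coeff f a)"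
proof (rule continuous_on_subset)
  show "continuous_on UNIV (\<lambda>f. fourier_coeff f a)"
    unfolding continuous_on_iff
    by (metis cmod_fourier_coeff_diff_le dist_norm le_less_trans)
qed simp

section \<open>Completeness of \<open>L\<^sup>2\<close> and Fourier synthesis\<close>

text \<open>A bound \<open>t\<close> on the L^2 norm bounds the L^1 norm, since the cube has measure
  1. The inequality |h| \<le> t/2 + |h|^2/(2t) takes the place of Cauchy-Schwarz.\<close>

lemma nn_integral_unit_cube_le:
  fixes h :: "real^'n::finite \<Rightarrow> complex"
  assumes h: "integrable unit_cube (\<lambda>x. (cmod (h x))\<^sup>2)" and [measurable]: "h \<in> borel_measurable unit_cube"
    and "t > 0" and le: "(LINT x|unit_cube. (cmod (h x))\<^sup>2) \<le> t\<^sup>2"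
  shows "(\<integral>\<^sup>+ x. ennreal (cmod (h x)) \<partial>unit_cube) \<le> ennreal t"
proof -
  interpret finite_measure "unit_cube :: (real^'n) measure" by (rule finite_measure_unit_cube)
  have am: "cmod (h x) \<le> t / 2 + (cmod (h x))\<^sup>2 / (2 * t)" for x
  proof -
    have "0 \<le> (cmod (h x) - t)\<^sup>2 / (2 * t)" using \<open>t > 0\<close> by simp
    also have "\<dots> = t / 2 + (cmod (h x))\<^sup>2 / (2 * t) - cmod (h x)"
      using \<open>t > 0\<close> by (simp add: power2_eq_square field_simps)
    finally show ?thesis by simp
  qed
  have "(\<integral>\<^sup>+ x. ennreal (cmod (h x)) \<partial>unit_cube)
    \<le> (\<integral>\<^sup>+ x. ennreal (t / 2 + (cmod (h x))\<^sup>2 / (2 * t)) \<partial>unit_cube)"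
    by (intro nn_integral_mono ennreal_leI am)
  also have "\<dots> = ennreal (LINT x|unit_cube. t / 2 + (cmod (h x))\<^sup>2 / (2 * t))"
    using h \<open>t > 0\<close> by (intro nn_integral_eq_integral) auto
  also have "(LINT x|unit_cube. t / 2 + (cmod (h x))\<^sup>2 / (2 * t))
    = t / 2 + (LINT x|unit_cube. (cmod (h x))\<^sup>2) / (2 * t)"
    using h by (simp add: measure_unit_cube)
  also have "\<dots> \<le> t / 2 + t\<^sup>2 / (2 * t)"
    using le \<open>t > 0\<close> by (intro add_left_mono divide_right_mono) auto
  also have "\<dots> = t" using \<open>t > 0\<close> by (simp add: power2_eq_square)
  finally show ?thesis by (simp add: ennreal_leI)
qed

text \<open>The increments of a rapidly Cauchy sequence are summable in \<open>L\<^sup>1\<close>, hence almost everywhere.\<close>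

lemma torus_L2_rapidly_Cauchy_AE_convergent:
  fixes f :: "nat \<Rightarrow> real^'n::finite \<Rightarrow> complex"
  assumes f: "\<And>k. f k \<in> torus_L2"
    and le: "\<And>k. (LINT x|unit_cube. (cmod (f (Suc k) x - f k x))\<^sup>2) \<le> ((1 / 2) ^ k)\<^sup>2"
  shows "AE x in unit_cube. convergent (\<lambda>k. f k x)"
proof -
  have [measurable]: "f k \<in> borel_measurable unit_cube" for k using f[of k] by measurable
  define d where "d k x = cmod (f (Suc k) x - f k x)" for k x
  have "(\<integral>\<^sup>+ x. suminf (\<lambda>k. ennreal (d k x)) \<partial>unit_cube) = suminf (\<lambda>k. \<integral>\<^sup>+ x. ennreal (d k x) \<partial>unit_cube)"
    unfolding d_def by (intro nn_integral_suminf) measurable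
  also have "\<dots> \<le> suminf (\<lambda>k. ennreal ((1 / 2) ^ k))"
    unfolding d_def
    by (intro suminf_le nn_integral_unit_cube_le torus_L2_integrable_diff f le) auto
  also have "\<dots> = ennreal (suminf (\<lambda>k. (1 / 2) ^ k))"
    by (rule suminf_ennreal2) (auto intro: summable_geometric)
  finally have "(\<integral>\<^sup>+ x. suminf (\<lambda>k. ennreal (d k x)) \<partial>unit_cube) \<le> ennreal (suminf (\<lambda>k. (1 / 2) ^ k))" .
  from le_less_trans[OF this ennreal_less_top]
  have "(\<integral>\<^sup>+ x. suminf (\<lambda>k. ennreal (d k x)) \<partial>unit_cube) \<noteq> \<infinity>"
    by (simp add: less_top)
  then have "AE x in unit_cube. suminf (\<lambda>k. ennreal (d k x)) \<noteq> \<infinity>"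
    by (intro nn_integral_PInf_AE) (auto simp: d_def)
  then show ?thesis
  proof eventually_elim
    case (elim x)
    then have "summable (\<lambda>k. d k x)"
      by (intro summable_suminf_not_top) (auto simp: d_def)
    then have "summable (\<lambda>k. f (Suc k) x - f k x)"
      unfolding d_def by (rule summable_norm_cancel)
    then have "convergent (\<lambda>n. f n x - f 0 x)"
      by (simp add: summable_iff_convergent sum_lessThan_telescope[of "\<lambda>n. f n x"])
    then show ?case by (simp add: convergent_diff_const_right_iff)
  qed
qed

lemma torus_L2_rapidly_Cauchy_limit:
  fixes f :: "nat \<Rightarrow> real^'n::finite \<Rightarrow> complex"
  assumes f: "\<And>k. f k \<in> torus_L2"
    and le: "\<And>k l. k \<le> l \<Longrightarrow> (LINT x|unit_cube. (cmod (f l x - f k x))\<^sup>2) \<le> ((1 / 2) ^ k)\<^sup>2"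
  shows "\<exists>g\<in>torus_L2. \<forall>k. (LINT x|unit_cube. (cmod (g x - f k x))\<^sup>2) \<le> ((1 / 2) ^ k)\<^sup>2"
proof (intro bexI allI)
  have fb: "f k \<in> borel_measurable lebesgue" for k using f[of k] by (simp add: torus_L2_def)
  have [measurable]: "f k \<in> borel_measurable unit_cube" for k using f[of k] by measurable
  \<comment> \<open>\<open>lim\<close> assigns a value even at points of divergence, and that value
    depends only on the sequence; so g is exactly periodic, not just almost everywhere.\<close>
  define g where "g x = lim (\<lambda>k. f k x)" for x
  have "g \<in> borel_measurable lebesgue"
    unfolding g_def by (rule borel_measurable_lim_metric[OF fb])
  then have [measurable]: "g \<in> borel_measurable unit_cube" by (rule measurable_restrict_space1)
  have periodic: "g (x + real_vec v) = g x" for x v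
    using f by (simp add: g_def torus_L2_def)
  have conv: "AE x in unit_cube. convergent (\<lambda>k. f k x)"
    using le[of k "Suc k" for k] by (intro torus_L2_rapidly_Cauchy_AE_convergent f) simp
  have nn: "(\<integral>\<^sup>+ x. ennreal ((cmod (g x - f k x))\<^sup>2) \<partial>unit_cube) \<le> ennreal (((1 / 2) ^ k)\<^sup>2)" for k
  proof -
    have "(\<integral>\<^sup>+ x. ennreal ((cmod (g x - f k x))\<^sup>2) \<partial>unit_cube)
      = (\<integral>\<^sup>+ x. liminf (\<lambda>l. ennreal ((cmod (f l x - f k x))\<^sup>2)) \<partial>unit_cube)"
    proof (rule nn_integral_cong_AE)
      show "AE x in unit_cube. ennreal ((cmod (g x - f k x))\<^sup>2) = liminf (\<lambda>l. ennreal ((cmod (f l x - f k x))\<^sup>2))"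
        using conv
      proof eventually_elim
        case (elim x)
        then have "(\<lambda>l. f l x) \<longlonglongrightarrow> g x" by (simp add: g_def convergent_LIMSEQ_iff)
        then have "(\<lambda>l. ennreal ((cmod (f l x - f k x))\<^sup>2)) \<longlonglongrightarrow> ennreal ((cmod (g x - f k x))\<^sup>2)"
          by (intro tendsto_intros)
        then show ?case by (intro lim_imp_Liminf[symmetric]) auto
      qed
    qed
    \<comment> \<open>Fatou's lemma turns the uniform bounds on f l - f k into a bound on g - f
      k.\<close>
    also have "\<dots> \<le> liminf (\<lambda>l. \<integral>\<^sup>+ x. ennreal ((cmod (f l x - f k x))\<^sup>2) \<partial>unit_cube)"
      by (rule nn_integral_liminf) measurable
    also have "\<dots> \<le> liminf (\<lambda>l. ennreal (((1 / 2) ^ k)\<^sup>2))"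
    proof (rule Liminf_mono)
      show "\<forall>\<^sub>F l in sequentially. (\<integral>\<^sup>+ x. ennreal ((cmod (f l x - f k x))\<^sup>2) \<partial>unit_cube) \<le> ennreal (((1 / 2) ^ k)\<^sup>2)"
        using eventually_ge_at_top[of k]
      proof eventually_elim
        case (elim l)
        then show ?case
          using le[OF elim] by (subst nn_integral_eq_integral[OF torus_L2_integrable_diff[OF f f]]) (auto intro: ennreal_leI)
      qed
    qed
    also have "\<dots> = ennreal (((1 / 2) ^ k)\<^sup>2)" by (simp add: Liminf_const)
    finally show ?thesis .
  qed
  have int: "integrable unit_cube (\<lambda>x. (cmod (g x - f k x))\<^sup>2)" for k
    using nn[of k] by (intro integrableI_bounded) (auto simp: le_less_trans ennreal_less_top)
  show "(LINT x|unit_cube. (cmod (g x - f k x))\<^sup>2) \<le> ((1 / 2) ^ k)\<^sup>2" for k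
    using nn[of k] by (subst (asm) nn_integral_eq_integral[OF int]) (auto simp: ennreal_le_iff)
  have "integrable unit_cube (\<lambda>x. (cmod (g x))\<^sup>2)"
  proof (rule Bochner_Integration.integrable_bound)
    show "integrable unit_cube (\<lambda>x. 2 * (cmod (g x - f 0 x))\<^sup>2 + 2 * (cmod (f 0 x))\<^sup>2)"
      using int torus_L2_integrable_sq[OF f] by simp
    have "(cmod (g x))\<^sup>2 \<le> 2 * (cmod (g x - f 0 x))\<^sup>2 + 2 * (cmod (f 0 x))\<^sup>2" for x
      using norm_add_sq_le[of 1 "g x - f 0 x" "f 0 x"] by simp
    then show "AE x in unit_cube. norm ((cmod (g x))\<^sup>2) \<le> norm (2 * (cmod (g x - f 0 x))\<^sup>2 + 2 * (cmod (f 0 x))\<^sup>2)"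
      by simp
  qed measurable
  then show "g \<in> torus_L2"
    using \<open>g \<in> borel_measurable lebesgue\<close> periodic by (simp add: torus_L2_def)
qed

lemma dist_abs_L2_torus:
  assumes "f \<in> torus_L2" "g \<in> torus_L2"
  shows "dist (abs_L2_torus f) (abs_L2_torus g) = sqrt (LINT x|unit_cube. (cmod (f x - g x))\<^sup>2)"
  using assms by (intro dist_L2_torus.abs_eq) (simp_all add: torus_L2_eq_def)

lemma L2_torus_representative:
  obtains f where "f \<in> torus_L2" "abs_L2_torus f = X"
  using Quotient3_rep_reflp[OF Quotient3_L2_torus, of X] Quotient3_abs_rep[OF Quotient3_L2_torus, of X]
  by (auto simp: torus_L2_eq_def)

text \<open>A Cauchy sequence converges once a subsequence does; the subsequence is chosen with
  geometric rate and lifted to representatives. Completeness is then available for nets over finite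
  index sets as well.\<close>

instance L2_torus :: (finite) complete_space
proof
  fix X :: "nat \<Rightarrow> 'a L2_torus" assume X: "Cauchy X"
  have "\<exists>r. \<forall>k. (\<forall>m\<ge>r k. \<forall>n\<ge>r k. dist (X m) (X n) \<le> (1 / 2) ^ k) \<and> r k < r (Suc k)"
  proof (rule dependent_nat_choice)
    have *: "\<exists>N>n. \<forall>m\<ge>N. \<forall>n\<ge>N. dist (X m) (X n) \<le> (1 / 2) ^ k" for n k :: nat
    proof -
      obtain M where "\<forall>m\<ge>M. \<forall>n\<ge>M. dist (X m) (X n) < (1 / 2) ^ k"
        using metric_CauchyD[OF X, of "(1 / 2) ^ k"] by auto
      then show ?thesis by (intro exI[of _ "max M (Suc n)"]) (auto intro: less_imp_le)
    qed
    show "\<exists>N. \<forall>m\<ge>N. \<forall>n\<ge>N. dist (X m) (X n) \<le> (1 / 2) ^ 0" using *[of 0 0] by blast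
    show "\<exists>N. (\<forall>m\<ge>N. \<forall>n\<ge>N. dist (X m) (X n) \<le> (1 / 2) ^ Suc k) \<and> n < N" for n k
      using *[of n "Suc k"] by blast
  qed
  then obtain r where r: "\<And>k m n. r k \<le> m \<Longrightarrow> r k \<le> n \<Longrightarrow> dist (X m) (X n) \<le> (1 / 2) ^ k"
    and mono: "strict_mono r" by (auto simp: strict_mono_Suc_iff)
  have "\<exists>f. f \<in> torus_L2 \<and> abs_L2_torus f = X (r k)" for k
    using L2_torus_representative by metis
  then obtain f where f: "\<And>k. f k \<in> torus_L2" "\<And>k. abs_L2_torus (f k) = X (r k)" by metis
  have sq: "(LINT x|unit_cube. (cmod (u x - v x))\<^sup>2) = (dist (abs_L2_torus u) (abs_L2_torus v))\<^sup>2"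
    if "u \<in> torus_L2" "v \<in> torus_L2" for u v :: "real^'a \<Rightarrow> complex"
    by (simp add: dist_abs_L2_torus[OF that])
  have le: "(LINT x|unit_cube. (cmod (f l x - f k x))\<^sup>2) \<le> ((1 / 2) ^ k)\<^sup>2" if "k \<le> l" for k l
  proof -
    have "r k \<le> r l" using mono that by (simp add: strict_mono_less_eq)
    then show ?thesis unfolding sq[OF f(1) f(1)] f(2) by (intro power_mono r) auto
  qed
  obtain g where g: "g \<in> torus_L2" "\<forall>k. (LINT x|unit_cube. (cmod (g x - f k x))\<^sup>2) \<le> ((1 / 2) ^ k)\<^sup>2"
    using torus_L2_rapidly_Cauchy_limit[OF f(1) le] by blast
  have "dist ((X \<circ> r) k) (abs_L2_torus g) \<le> (1 / 2) ^ k" for k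
    using g(2)[rule_format, of k] unfolding sq[OF g(1) f(1)] f(2) by (auto simp: dist_commute intro: power2_le_imp_le)
  then have "(\<lambda>k. dist ((X \<circ> r) k) (abs_L2_torus g)) \<longlonglongrightarrow> 0"
    by (intro tendsto_sandwich[OF _ _ tendsto_const LIMSEQ_realpow_zero[of "1 / 2"]]) auto
  then have "(X \<circ> r) \<longlonglongrightarrow> abs_L2_torus g" by (rule tendsto_dist_iff[THEN iffD2])
  then show "convergent X" using Cauchy_converges_subseq[OF X mono] by (auto simp: convergent_def)
qed

section \<open>Fourier synthesis\<close>

lemma dist_trig_poly_subset:
  assumes "finite F" "G \<subseteq> F"
  shows "(dist (trig_poly F c) (trig_poly G c))\<^sup>2 = (\<Sum>a\<in>F - G. (cmod (c a))\<^sup>2)"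
proof -
  have "trig_poly G c = trig_poly F (\<lambda>a. if a \<in> G then c a else 0)"
  proof -
    have "(\<Sum>a\<in>G. c a * cnj (fourier_basis a x))
      = (\<Sum>a\<in>F. (if a \<in> G then c a else 0) * cnj (fourier_basis a x))" for x
      using assms by (intro sum.mono_neutral_cong_left) auto
    then show ?thesis by (simp add: trig_poly_def)
  qed
  then have "(dist (trig_poly F c) (trig_poly G c))\<^sup>2
    = (\<Sum>a\<in>F. (cmod (c a - (if a \<in> G then c a else 0)))\<^sup>2)"
    by (simp add: dist_trig_poly[OF assms(1)])
  also have "\<dots> = (\<Sum>a\<in>F - G. (cmod (c a))\<^sup>2)"
    using assms by (intro sum.mono_neutral_cong_right) auto
  finally show ?thesis .
qed

text \<open>By orthonormality the squared distance between nested partial sums is a piece of the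
  tail of a convergent series, so the net of partial sums is Cauchy.\<close>

lemma trig_poly_convergent:
  assumes "(\<lambda>a. (cmod (c a))\<^sup>2) summable_on UNIV"
  shows "\<exists>f. ((\<lambda>F. trig_poly F c) \<longlongrightarrow> f) (finite_subsets_at_top UNIV)"
proof -
  have "cauchy_filter (filtermap (\<lambda>F. trig_poly F c) (finite_subsets_at_top UNIV))"
    unfolding cauchy_filter_metric_filtermap
  proof (intro allI impI)
    fix e :: real assume "e > 0"
    let ?s = "\<lambda>a. (cmod (c a))\<^sup>2"
    have "(sum ?s \<longlongrightarrow> infsum ?s UNIV) (finite_subsets_at_top UNIV)"
      using has_sum_infsum[OF assms] by (simp add: has_sum_def)
    then have "\<forall>\<^sub>F F in finite_subsets_at_top UNIV. infsum ?s UNIV - (e / 2)\<^sup>2 < sum ?s F"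
      using \<open>e > 0\<close> by (intro order_tendstoD(1)) auto
    then obtain G where G: "finite G" "infsum ?s UNIV - (e / 2)\<^sup>2 < sum ?s G"
      unfolding eventually_finite_subsets_at_top by blast
    have near: "dist (trig_poly F c) (trig_poly G c) < e / 2" if "finite F" "G \<subseteq> F" for F
    proof (rule power_less_imp_less_base)
      have "(dist (trig_poly F c) (trig_poly G c))\<^sup>2 = sum ?s F - sum ?s G"
        unfolding dist_trig_poly_subset[OF that] using that G(1) by (simp add: sum_diff)
      also have "\<dots> < (e / 2)\<^sup>2"
        using finite_sum_le_infsum[OF assms that(1)] G(2) by simp
      finally show "(dist (trig_poly F c) (trig_poly G c))\<^sup>2 < (e / 2)\<^sup>2" .
    qed (use \<open>e > 0\<close> in simp)
    show "\<exists>P. eventually P (finite_subsets_at_top UNIV)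
      \<and> (\<forall>F H. P F \<and> P H \<longrightarrow> dist (trig_poly F c) (trig_poly H c) < e)"
    proof (intro exI[of _ "\<lambda>F. finite F \<and> G \<subseteq> F"] conjI allI impI)
      show "\<forall>\<^sub>F F in finite_subsets_at_top UNIV. finite F \<and> G \<subseteq> F"
        using G(1) unfolding eventually_finite_subsets_at_top by blast
      fix F H assume FH: "(finite F \<and> G \<subseteq> F) \<and> finite H \<and> G \<subseteq> H"
      show "dist (trig_poly F c) (trig_poly H c) < e"
        by (rule dist_triangle_half_l[of _ "trig_poly G c"]) (use FH near in auto)
    qed
  qed
  from cauchy_filter_complete_converges[OF this complete_UNIV] show ?thesis
    by (simp add: filterlim_def filtermap_bot_iff)
qed

text \<open>The limit runs over the finite subsets of the index lattice, so no enumeration is chosen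
  and the mode of convergence matches that of \<open>infsum\<close>.\<close>

definition fourier_series :: "(int^'n) ell2 \<Rightarrow> 'n::finite L2_torus"
  where "fourier_series c = Lim (finite_subsets_at_top UNIV) (\<lambda>F. trig_poly F (coord c))"

lemma trig_poly_tendsto_fourier_series:
  "((\<lambda>F. trig_poly F (coord c)) \<longlongrightarrow> fourier_series c) (finite_subsets_at_top UNIV)"
  using trig_poly_convergent[OF coord_summable[of c]] tendsto_Lim[OF finite_subsets_at_top_neq_bot]
  unfolding fourier_series_def by blast

text \<open>Coefficients are continuous, and along the partial sums the coefficient at
  \<open>a\<close> is constant as soon as \<open>a\<close> belongs to the finite set.\<close>

lemma fourier_coeff_fourier_series [simp]: "fourier_coeff (fourier_series c) a = coord c a"
proof (rule tendsto_unique[OF finite_subsets_at_top_neq_bot])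
  show "((\<lambda>F. fourier_coeff (trig_poly F (coord c)) a) \<longlongrightarrow> fourier_coeff (fourier_series c) a)
    (finite_subsets_at_top UNIV)"
    by (rule continuous_on_tendsto_compose[OF continuous_on_fourier_coeff[of UNIV] trig_poly_tendsto_fourier_series])
      auto
  have "\<forall>\<^sub>F F in finite_subsets_at_top UNIV. fourier_coeff (trig_poly F (coord c)) a = coord c a"
    unfolding eventually_finite_subsets_at_top
    by (intro exI[of _ "{a}"]) (simp add: fourier_coeff_trig_poly)
  then show "((\<lambda>F. fourier_coeff (trig_poly F (coord c)) a) \<longlongrightarrow> coord c a) (finite_subsets_at_top UNIV)"
    by (rule tendsto_eventually)
qed

lemma fourier_map_fourier_series [simp]: "fourier_map (fourier_series c) = c"
  by (simp add: coord_inject[symmetric] fun_eq_iff)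

text \<open>Parseval's identity gives the estimate for partial sums, and it passes to the
  limit.\<close>

lemma dist_fourier_series_le: "dist (fourier_series c) (fourier_series d) \<le> dist c d"
proof (rule tendsto_upperbound)
  show "((\<lambda>F. dist (trig_poly F (coord c)) (trig_poly F (coord d))) \<longlongrightarrow> dist (fourier_series c) (fourier_series d))
    (finite_subsets_at_top UNIV)"
    by (intro tendsto_intros trig_poly_tendsto_fourier_series)
  show "\<forall>\<^sub>F F in finite_subsets_at_top UNIV. dist (trig_poly F (coord c)) (trig_poly F (coord d)) \<le> dist c d"
  proof (rule eventually_finite_subsets_at_top_weakI)
    fix F :: "(int^'a) set" assume "finite F"
    then have "(dist (trig_poly F (coord c)) (trig_poly F (coord d)))\<^sup>2 \<le> (dist c d)\<^sup>2"
      unfolding dist_trig_poly[OF \<open>finite F\<close>] dist_ell2_sq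
      by (intro finite_sum_le_infsum coord_diff_summable) auto
    then show "dist (trig_poly F (coord c)) (trig_poly F (coord d)) \<le> dist c d"
      by (rule power2_le_imp_le) simp
  qed
qed simp

lemma continuous_on_fourier_series: "continuous_on S fourier_series"
  unfolding continuous_on_iff using dist_fourier_series_le by (meson le_less_trans)

section \<open>The Sobolev ball in Fourier coordinates\<close>

lemma sobolev_ball_iff: "f \<in> sobolev_ball m \<longleftrightarrow> fourier_map f \<in> sobolev_ellipsoid m"
proof -
  let ?s = "\<lambda>a. sobolev_weight m a * (cmod (fourier_coeff f a))\<^sup>2"
  have nonneg: "0 \<le> ?s a" for a using sobolev_weight_ge_1[of m a] by simp
  have "f \<in> sobolev_ball m \<longleftrightarrow> ?s summable_on UNIV \<and> infsum ?s UNIV \<le> 1"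
    by (simp add: sobolev_ball_def sobolev_space_def sobolev_norm_def)
  also have "\<dots> \<longleftrightarrow> (\<forall>F. finite F \<longrightarrow> sum ?s F \<le> 1)"
  proof (intro iffI allI impI; (elim conjE)?)
    fix F :: "(int^'a) set" assume "?s summable_on UNIV" "infsum ?s UNIV \<le> 1" "finite F"
    then show "sum ?s F \<le> 1"
      using finite_sum_le_infsum[of ?s UNIV F] nonneg by force
  next
    assume "\<forall>F. finite F \<longrightarrow> sum ?s F \<le> 1"
    then show "?s summable_on UNIV \<and> infsum ?s UNIV \<le> 1"
      using sum_bounded_imp_summable[of ?s 1] nonneg by blast
  qed
  finally show ?thesis by (simp add: sobolev_ellipsoid_def)
qed

text \<open>Synthesis provides a preimage for every point of the ellipsoid, so E is the compact
  ellipsoid itself.\<close>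

lemma fourier_map_sobolev_ball: "fourier_map ` sobolev_ball m = sobolev_ellipsoid m"
proof (intro equalityI subsetI)
  fix c :: "(int^'a) ell2" assume "c \<in> sobolev_ellipsoid m"
  then show "c \<in> fourier_map ` sobolev_ball m"
    by (intro image_eqI[of _ _ "fourier_series c"]) (simp_all add: sobolev_ball_iff)
qed (auto simp: sobolev_ball_iff)

text \<open>Closedness makes the ball a Borel set, as the image measure requires.\<close>

lemma closed_sobolev_ball: "closed (sobolev_ball m :: 'n::finite L2_torus set)"
proof -
  have "(sobolev_ball m :: 'n L2_torus set) = (\<Inter>F\<in>Collect finite. {f. (\<Sum>a\<in>F. sobolev_weight m a * (cmod (fourier_coeff f a))\<^sup>2) \<le> 1})"
    by (auto simp: sobolev_ball_iff sobolev_ellipsoid_def)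
  moreover have "closed \<dots>"
    by (intro closed_INT ballI closed_Collect_le continuous_intros continuous_on_fourier_coeff)
  ultimately show ?thesis by simp
qed

section \<open>Radon measures\<close>

lemma radon_measure_compact_finite:
  assumes "radon_measure \<mu>" "compact K"
  shows "emeasure \<mu> K < \<infinity>"
proof -
  have sets: "sets \<mu> = sets borel" using assms(1) by (simp add: radon_measure_def)
  have "\<forall>x. \<exists>U. open U \<and> x \<in> U \<and> emeasure \<mu> U < \<infinity>"
    using assms(1) by (simp add: radon_measure_def)
  then obtain U where U: "\<And>x. open (U x)" "\<And>x. x \<in> U x" "\<And>x. emeasure \<mu> (U x) < \<infinity>" by metis
  obtain X where X: "finite X" "K \<subseteq> (\<Union>x\<in>X. U x)"
    by (rule compactE_image[OF assms(2), of K U]) (use U(1,2) in auto)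
  have "emeasure \<mu> K \<le> emeasure \<mu> (\<Union>x\<in>X. U x)"
    using X U(1) by (intro emeasure_mono) (auto simp: sets)
  also have "\<dots> \<le> (\<Sum>x\<in>X. emeasure \<mu> (U x))"
    using X U(1) by (intro emeasure_subadditive_finite) (auto simp: sets)
  also have "\<dots> < \<infinity>" using X(1) U(3) by (auto simp: less_top[symmetric])
  finally show ?thesis .
qed

text \<open>A continuous function is bounded on \<open>K\<close>, and \<open>K\<close> has finite
  measure. This is the source of integrability for all moments.\<close>

lemma radon_measure_set_integrable:
  fixes f :: "'a::t2_space \<Rightarrow> 'b::{banach, second_countable_topology}"
  assumes "radon_measure \<mu>" "compact K" "continuous_on UNIV f"
  shows "set_integrable \<mu> K f"
proof -
  have sets[measurable_cong]: "sets \<mu> = sets borel" using assms(1) by (simp add: radon_measure_def)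
  have [measurable]: "K \<in> sets \<mu>" using compact_imp_closed[OF assms(2)] by (simp add: sets)
  have [measurable]: "f \<in> borel_measurable \<mu>"
    using borel_measurable_continuous_onI[OF assms(3)] sets measurable_cong_sets by blast
  have "compact (f ` K)"
    by (rule compact_continuous_image[OF continuous_on_subset[OF assms(3)] assms(2)]) simp
  then obtain C where "\<forall>y\<in>f ` K. norm y \<le> C"
    using compact_imp_bounded bounded_iff by blast
  then have C: "\<And>x. x \<in> K \<Longrightarrow> norm (f x) \<le> C" by blast
  show ?thesis
    unfolding set_integrable_def
    by (rule integrableI_bounded_set_indicator)
      (use radon_measure_compact_finite[OF assms(1,2)] C in auto)
qed

text \<open>Inner regularity passes to the image measure because a continuous image of a compact set is compact.\<close>

lemma radon_measure_distr_density:
  fixes \<psi> :: "'a::t2_space \<Rightarrow> 'b::t2_space" and h :: "'a \<Rightarrow> real"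
  assumes \<mu>: "radon_measure \<mu>" and K: "compact K"
    and h: "continuous_on UNIV h" "\<And>x. 0 \<le> h x" and \<psi>: "continuous_on UNIV \<psi>"
  shows "radon_measure (distr (density \<mu> (\<lambda>x. ennreal (indicator K x * h x))) borel \<psi>)"
proof -
  have sets[measurable_cong, simp]: "sets \<mu> = sets borel" using \<mu> by (simp add: radon_measure_def)
  have space [simp]: "space \<mu> = UNIV" using sets_eq_imp_space_eq[OF sets] by simp
  have [measurable]: "h \<in> borel_measurable borel" "\<psi> \<in> borel_measurable borel"
    by (intro borel_measurable_continuous_onI h \<psi>)+
  have K_sets[measurable]: "K \<in> sets borel" using compact_imp_closed[OF K] by simp
  obtain C where C: "C > 0" "\<And>x. x \<in> K \<Longrightarrow> h x \<le> C"
  proof -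
    have "compact (h ` K)"
      by (rule compact_continuous_image[OF continuous_on_subset[OF h(1)] K]) simp
    then obtain C where "\<forall>y\<in>h ` K. norm y \<le> C"
      using compact_imp_bounded bounded_iff by blast
    \<comment> \<open>The maximum with 1 keeps the bound positive, as the later division by C
      requires.\<close>
    then have "h x \<le> max C 1" if "x \<in> K" for x using that by fastforce
    then show thesis by (intro that[of "max C 1"]) auto
  qed
  define M where "M = density \<mu> (\<lambda>x. ennreal (indicator K x * h x))"
  define N where "N = distr M borel \<psi>"
  have [measurable_cong, simp]: "sets M = sets borel" by (simp add: M_def)
  have [simp]: "space M = UNIV" by (simp add: M_def)
  have M_le: "emeasure M S \<le> ennreal C * emeasure \<mu> (K \<inter> S)" if [measurable]: "S \<in> sets borel" for S
  proof -
    have "emeasure M S = (\<integral>\<^sup>+ x. ennreal (indicator K x * h x) * indicator S x \<partial>\<mu>)"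
      unfolding M_def by (rule emeasure_density) auto
    also have "\<dots> \<le> (\<integral>\<^sup>+ x. ennreal C * indicator (K \<inter> S) x \<partial>\<mu>)"
      using C by (intro nn_integral_mono) (auto simp: indicator_def ennreal_leI)
    also have "\<dots> = ennreal C * emeasure \<mu> (K \<inter> S)"
      by (rule nn_integral_cmult_indicator) simp
    finally show ?thesis .
  qed
  have M_outside: "emeasure M S = emeasure M (K \<inter> S)" if [measurable]: "S \<in> sets borel" for S
  proof -
    have "emeasure M (S - K) \<le> 0" using M_le[of "S - K"] by (simp add: Diff_Int_distrib2 Int_Diff)
    moreover have "emeasure M S = emeasure M (K \<inter> S) + emeasure M (S - K)"
      by (subst plus_emeasure) (auto intro!: arg_cong[where f = "emeasure M"])
    ultimately show ?thesis by simp
  qed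
  have N: "emeasure N S = emeasure M (\<psi> -` S)" if [measurable]: "S \<in> sets borel" for S
    unfolding N_def by (subst emeasure_distr) auto
  have K_fin: "emeasure \<mu> K < \<infinity>" by (rule radon_measure_compact_finite[OF \<mu> K])
  show ?thesis
    unfolding M_def[symmetric] N_def[symmetric] radon_measure_def
  proof (intro conjI allI ballI)
    show "sets N = sets borel" by (simp add: N_def)
  next
    fix x :: 'b
    have "emeasure N UNIV \<le> ennreal C * emeasure \<mu> K" using M_le[of UNIV] by (simp add: N)
    also have "\<dots> < \<infinity>" using K_fin by (simp add: ennreal_mult_less_top)
    finally show "\<exists>U. open U \<and> x \<in> U \<and> emeasure N U < \<infinity>" by (intro exI[of _ UNIV]) auto
  next
    fix S :: "'b set" assume S[measurable]: "S \<in> sets borel"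
    let ?R = "SUP L\<in>{L. compact L \<and> L \<subseteq> S}. emeasure N L"
    \<comment> \<open>Inside K the preimage of S has finite measure, so inner regularity gives a
      compact subset with small difference.\<close>
    define T where "T = K \<inter> \<psi> -` S"
    have T[measurable]: "T \<in> sets borel"
      unfolding T_def using measurable_sets[of \<psi> borel borel S] by simp
    have T_fin: "emeasure \<mu> T < \<infinity>"
      by (rule le_less_trans[OF emeasure_mono K_fin]) (auto simp: T_def)
    show "emeasure N S = ?R"
    proof (rule antisym)
      show "emeasure N S \<le> ?R"
      proof (rule ennreal_le_epsilon)
        fix e :: real assume "0 < e"
        have "emeasure \<mu> T = (SUP L\<in>{L. compact L \<and> L \<subseteq> T}. emeasure \<mu> L)"
          using \<mu> T by (simp add: radon_measure_def)
        moreover have "emeasure \<mu> T \<noteq> \<infinity>" using T_fin by simp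
        moreover have "{L. compact L \<and> L \<subseteq> T} \<noteq> {}" by (auto intro: exI[of _ "{}"])
        \<comment> \<open>The density is at most C on K, so an error of e / C for \<mu> becomes an
          error of e for M.\<close>
        moreover have "0 < e / C" using \<open>0 < e\<close> C by simp
        ultimately obtain L where L: "compact L" "L \<subseteq> T" "emeasure \<mu> T < emeasure \<mu> L + ennreal (e / C)"
          using SUP_approx_ennreal[of "e / C" "{L. compact L \<and> L \<subseteq> T}" "emeasure \<mu> T" "emeasure \<mu>"] by auto
        have [measurable]: "L \<in> sets borel" using compact_imp_closed[OF L(1)] by simp
        have L_fin: "emeasure \<mu> L < \<infinity>" by (rule radon_measure_compact_finite[OF \<mu> L(1)])
        have "emeasure \<mu> (T - L) \<le> ennreal (e / C)"
        proof -
          have "emeasure \<mu> L + emeasure \<mu> (T - L) = emeasure \<mu> T"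
            using L(2) by (subst plus_emeasure) (auto intro!: arg_cong[where f = "emeasure \<mu>"])
          also have "\<dots> \<le> emeasure \<mu> L + ennreal (e / C)" using L(3) by simp
          finally show ?thesis using L_fin by (auto simp: ennreal_add_left_cancel_le)
        qed
        have cL: "compact (\<psi> ` L)"
          by (rule compact_continuous_image[OF continuous_on_subset[OF \<psi>] L(1)]) simp
        then have [measurable]: "\<psi> ` L \<in> sets borel" by (intro borel_closed compact_imp_closed)
        have "emeasure N S = emeasure M T"
          unfolding T_def N[OF S] using measurable_sets[of \<psi> borel borel S] by (intro M_outside) simp
        also have "\<dots> = emeasure M L + emeasure M (T - L)"
          using L(2) by (subst plus_emeasure) (auto intro!: arg_cong[where f = "emeasure M"])
        also have "emeasure M L \<le> emeasure N (\<psi> ` L)"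
        proof -
          have "\<psi> -` (\<psi> ` L) \<in> sets borel" using measurable_sets[of \<psi> borel borel "\<psi> ` L"] by simp
          then show ?thesis by (subst N) (auto intro!: emeasure_mono)
        qed
        also have "emeasure N (\<psi> ` L) \<le> ?R"
          using cL L(2) by (intro SUP_upper) (auto simp: T_def)
        also have "emeasure M (T - L) \<le> ennreal e"
        proof -
          have "emeasure M (T - L) \<le> ennreal C * emeasure \<mu> (K \<inter> (T - L))" by (rule M_le) simp
          also have "K \<inter> (T - L) = T - L" by (auto simp: T_def)
          also have "ennreal C * emeasure \<mu> (T - L) \<le> ennreal C * ennreal (e / C)"
            by (intro mult_left_mono) (fact, simp)
          also have "\<dots> = ennreal e" using C(1) \<open>0 < e\<close> by (simp flip: ennreal_mult)
          finally show ?thesis .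
        qed
        finally show "emeasure N S \<le> ?R + ennreal e" by (simp add: add_mono)
      qed
      show "?R \<le> emeasure N S"
        by (intro SUP_least emeasure_mono) (auto simp: N_def)
    qed
  qed
qed

section \<open>The moment cone and its inner approximation\<close>

lemma eval_fpoly_ball_poly:
  assumes "hermitian_seq c"
  shows "eval_fpoly (ball_poly m \<rho>) c =
    complex_of_real (1 - (\<Sum>a\<in>{a. index_degree a \<le> \<rho>}. sobolev_weight m a * (cmod (coord c a))\<^sup>2))"
  using assms
  by (simp add: ball_poly_def eval_fpoly_diff eval_fpoly_sum hermitian_seq_def complex_norm_square mult.assoc
    del: of_real_power)

lemma eval_fpoly_sos_cone:
  assumes "hermitian_seq c" "s \<in> sos_cone r \<rho>"
  shows "\<exists>t\<ge>0. eval_fpoly s c = complex_of_real t"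
proof -
  obtain qs where s: "s = (\<Sum>q\<leftarrow>qs. herm_conj q * q)" using assms(2) by (auto simp: sos_cone_def)
  have "cnj z * z = complex_of_real ((cmod z)\<^sup>2)" for z
    by (simp only: complex_norm_square) (rule mult.commute)
  then have "eval_fpoly s c = complex_of_real (\<Sum>q\<leftarrow>qs. (cmod (eval_fpoly q c))\<^sup>2)"
    unfolding s eval_fpoly_sum_list eval_fpoly_mult eval_fpoly_herm_conj[OF assms(1)]
    by (induction qs) simp_all
  then show ?thesis by (intro exI[of _ "\<Sum>q\<leftarrow>qs. (cmod (eval_fpoly q c))\<^sup>2"]) (auto intro!: sum_list_nonneg)
qed

lemma zero_in_sos_cone: "0 \<in> sos_cone r \<rho>"
  unfolding sos_cone_def by (auto intro!: exI[of _ "[]"])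

lemma eval_fpoly_quadratic_module:
  assumes c: "hermitian_seq c" "c \<in> sobolev_ellipsoid m" and p: "p \<in> quadratic_module m r \<rho>"
  shows "\<exists>t\<ge>0. eval_fpoly p c = complex_of_real t"
proof -
  obtain s\<^sub>0 s\<^sub>1 where p: "p = s\<^sub>0 + s\<^sub>1 * ball_poly m \<rho>" "s\<^sub>0 \<in> sos_cone r \<rho>"
    and "s\<^sub>1 \<in> (if r = 0 then {0} else sos_cone (r - 1) \<rho>)"
    using p unfolding quadratic_module_def by blast
  \<comment> \<open>For r = 0 natural subtraction gives r - 1 = 0, and the zero polynomial lies in
    that cone too; both cases of the definition are covered.\<close>
  then have s\<^sub>1: "s\<^sub>1 \<in> sos_cone (r - 1) \<rho>" by (auto simp: zero_in_sos_cone split: if_splits)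
  obtain t\<^sub>0 t\<^sub>1 where t: "t\<^sub>0 \<ge> 0" "eval_fpoly s\<^sub>0 c = complex_of_real t\<^sub>0" "t\<^sub>1 \<ge> 0" "eval_fpoly s\<^sub>1 c = complex_of_real t\<^sub>1"
    using eval_fpoly_sos_cone[OF c(1) p(2)] eval_fpoly_sos_cone[OF c(1) s\<^sub>1] by blast
  define b where "b = 1 - (\<Sum>a\<in>{a. index_degree a \<le> \<rho>}. sobolev_weight m a * (cmod (coord c a))\<^sup>2)"
  \<comment> \<open>The sum is one of the finite partial sums that the ellipsoid bounds by
    1.\<close>
  have "b \<ge> 0" using c(2) by (simp add: b_def sobolev_ellipsoid_def finite_index_degree_le)
  moreover have "eval_fpoly p c = complex_of_real (t\<^sub>0 + t\<^sub>1 * b)"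
    by (simp add: p(1) eval_fpoly_add eval_fpoly_mult t eval_fpoly_ball_poly[OF c(1)] b_def)
  ultimately show ?thesis using t by (intro exI[of _ "t\<^sub>0 + t\<^sub>1 * b"]) simp
qed

text \<open>Densities are arbitrary functions rather than polynomials, so that conjugated values can
  occur in them.\<close>

definition moment_vector ::
    "(int^'n::finite) ell2 measure \<Rightarrow> (int^'n) ell2 set \<Rightarrow> ((int^'n) multiset)^'k
      \<Rightarrow> ((int^'n) ell2 \<Rightarrow> complex) \<Rightarrow> complex^'k"
  where "moment_vector \<gamma> E A g = (\<chi> j. LINT c:E|\<gamma>. eval_monom c (A $ j) * g c)"

section \<open>Moment vectors as linear functions of the density\<close>

context
  fixes \<gamma> :: "(int^'n::finite) ell2 measure" and E and A :: "((int^'n) multiset)^'k"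
  assumes radon: "radon_measure \<gamma>" and compact: "compact E"
    and herm: "AE c in \<gamma>. c \<in> E \<longrightarrow> hermitian_seq c"
begin

lemma moment_vector_add:
  assumes "continuous_on UNIV g" "continuous_on UNIV h"
  shows "moment_vector \<gamma> E A (\<lambda>c. g c + h c) = moment_vector \<gamma> E A g + moment_vector \<gamma> E A h"
  unfolding moment_vector_def vec_eq_iff vector_add_component vec_lambda_beta distrib_left
  by (intro allI set_integral_add radon_measure_set_integrable[OF radon compact]
      continuous_intros continuous_on_eval_monom assms)

lemma moment_vector_zero: "moment_vector \<gamma> E A (\<lambda>c. 0) = 0"
  by (simp add: moment_vector_def vec_eq_iff)

lemma moment_vector_scaleR:
  "moment_vector \<gamma> E A (\<lambda>c. complex_of_real t * g c) = t *\<^sub>R moment_vector \<gamma> E A g"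
proof -
  have eq: "eval_monom c as * (complex_of_real t * g c) = complex_of_real t * (eval_monom c as * g c)" for c as
    by simp
  show ?thesis
    unfolding moment_vector_def vec_eq_iff vector_scaleR_component vec_lambda_beta eq
      set_integral_mult_right by (simp add: scaleR_conv_of_real)
qed

lemma moment_vector_sum:
  assumes "\<And>i. i \<in> I \<Longrightarrow> continuous_on UNIV (g i)"
  shows "moment_vector \<gamma> E A (\<lambda>c. \<Sum>i\<in>I. g i c) = (\<Sum>i\<in>I. moment_vector \<gamma> E A (g i))"
  using assms
proof (induction I rule: infinite_finite_induct)
  case (insert i I)
  have "continuous_on UNIV (\<lambda>c. \<Sum>i\<in>I. g i c)" by (intro continuous_intros insert.prems) simp
  then show ?case using insert by (simp add: moment_vector_add)
qed (simp_all add: moment_vector_zero)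

lemma moment_vector_sum_list:
  assumes "\<And>q. q \<in> set qs \<Longrightarrow> continuous_on UNIV (g q)"
  shows "moment_vector \<gamma> E A (\<lambda>c. \<Sum>q\<leftarrow>qs. g q c) = (\<Sum>q\<leftarrow>qs. moment_vector \<gamma> E A (g q))"
  using assms
proof (induction qs)
  case (Cons q qs)
  have "continuous_on UNIV (\<lambda>c. \<Sum>q\<leftarrow>qs. g q c)"
    using Cons.prems by (induction qs) (auto intro!: continuous_intros)
  then show ?case using Cons by (simp add: moment_vector_add)
qed (simp add: moment_vector_zero)

text \<open>Allows the replacement of \<open>herm_conj q\<close> by the conjugate of q under the
  integral, where the two agree only at Hermitian points.\<close>

lemma moment_vector_cong:
  assumes "continuous_on UNIV g" "continuous_on UNIV h"
    and eq: "\<And>c. hermitian_seq c \<Longrightarrow> g c = h c"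
  shows "moment_vector \<gamma> E A g = moment_vector \<gamma> E A h"
proof -
  have sets: "sets \<gamma> = sets borel" using radon by (simp add: radon_measure_def)
  have "(LINT c:E|\<gamma>. eval_monom c as * g c) = (LINT c:E|\<gamma>. eval_monom c as * h c)" for as
  proof -
    have "set_integrable \<gamma> E (\<lambda>c. eval_monom c as * g c)" "set_integrable \<gamma> E (\<lambda>c. eval_monom c as * h c)"
      by (intro radon_measure_set_integrable[OF radon compact] continuous_intros continuous_on_eval_monom assms)+
    moreover have "AE c in \<gamma>. indicator E c *\<^sub>R (eval_monom c as * g c) = indicator E c *\<^sub>R (eval_monom c as * h c)"
      using herm by eventually_elim (auto simp: eq indicator_def)
    ultimately show ?thesis
      unfolding set_lebesgue_integral_def set_integrable_def
      by (intro integral_cong_AE) (auto dest: borel_measurable_integrable)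
  qed
  then show ?thesis by (simp add: moment_vector_def)
qed

text \<open>In real coordinates \<open>x\<close> of \<open>q\<close>, the moments of \<open>q\<^sup>* q b\<close> are a quadratic form in \<open>x\<close>.\<close>

lemma moment_vectors_sos_cone:
  "\<exists>k z. {moment_vector \<gamma> E A (eval_fpoly (s * b)) | s. s \<in> sos_cone r \<rho>} = sos_values k z"
proof -
  obtain k and u :: "nat \<Rightarrow> 'n fpoly" where
    u1: "\<forall>q\<in>bounded_polys r \<rho>. \<exists>x. \<forall>c. eval_fpoly q c = (\<Sum>i<k. complex_of_real (x i) * eval_fpoly (u i) c)" and
    u2: "\<forall>x. \<exists>q\<in>bounded_polys r \<rho>. \<forall>c. eval_fpoly q c = (\<Sum>i<k. complex_of_real (x i) * eval_fpoly (u i) c)"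
    using bounded_polys_real_basis[where r = r and \<rho> = \<rho>] by (elim exE conjE) (rule that)
  define z where "z i j = moment_vector \<gamma> E A (\<lambda>c. cnj (eval_fpoly (u i) c) * eval_fpoly (u j) c * eval_fpoly b c)"
    for i j
  define f where "f x = (\<Sum>i<k. \<Sum>j<k. (x i * x j) *\<^sub>R z i j)" for x
  note cont = continuous_intros continuous_on_eval_fpoly
  have square: "moment_vector \<gamma> E A (eval_fpoly (herm_conj q * q * b)) = f x"
    if x: "\<forall>c. eval_fpoly q c = (\<Sum>i<k. complex_of_real (x i) * eval_fpoly (u i) c)" for q x
  proof -
    \<comment> \<open>Real coordinates pass through the conjugation unchanged, so the coefficients
      are the real products x i * x j.\<close>
    have "moment_vector \<gamma> E A (eval_fpoly (herm_conj q * q * b))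
      = moment_vector \<gamma> E A (\<lambda>c. \<Sum>i<k. \<Sum>j<k. complex_of_real (x i * x j) *
          (cnj (eval_fpoly (u i) c) * eval_fpoly (u j) c * eval_fpoly b c))"
    proof (rule moment_vector_cong)
      fix c :: "(int^'n) ell2" assume "hermitian_seq c"
      then show "eval_fpoly (herm_conj q * q * b) c = (\<Sum>i<k. \<Sum>j<k. complex_of_real (x i * x j) *
          (cnj (eval_fpoly (u i) c) * eval_fpoly (u j) c * eval_fpoly b c))"
        by (simp add: eval_fpoly_mult eval_fpoly_herm_conj x sum_product sum_distrib_left mult_ac)
    qed (intro cont)+
    also have "\<dots> = (\<Sum>i<k. moment_vector \<gamma> E A (\<lambda>c. \<Sum>j<k. complex_of_real (x i * x j) *
          (cnj (eval_fpoly (u i) c) * eval_fpoly (u j) c * eval_fpoly b c)))"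
      by (rule moment_vector_sum) (intro cont)
    also have "\<dots> = (\<Sum>i<k. \<Sum>j<k. moment_vector \<gamma> E A (\<lambda>c. complex_of_real (x i * x j) *
          (cnj (eval_fpoly (u i) c) * eval_fpoly (u j) c * eval_fpoly b c)))"
      by (intro sum.cong refl moment_vector_sum cont)
    also have "\<dots> = f x" unfolding moment_vector_scaleR f_def z_def ..
    finally show ?thesis .
  qed
  have list: "moment_vector \<gamma> E A (eval_fpoly ((\<Sum>q\<leftarrow>qs. herm_conj q * q) * b))
    = (\<Sum>q\<leftarrow>qs. moment_vector \<gamma> E A (eval_fpoly (herm_conj q * q * b)))" for qs
  proof -
    have "eval_fpoly ((\<Sum>q\<leftarrow>qs. herm_conj q * q) * b) = (\<lambda>c. \<Sum>q\<leftarrow>qs. eval_fpoly (herm_conj q * q * b) c)"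
      by (simp add: fun_eq_iff eval_fpoly_mult eval_fpoly_sum_list sum_list_mult_const)
    then show ?thesis by (simp add: moment_vector_sum_list[OF continuous_on_eval_fpoly])
  qed
  have "{moment_vector \<gamma> E A (eval_fpoly (s * b)) | s. s \<in> sos_cone r \<rho>} = sos_values k z"
  proof (intro equalityI subsetI)
    fix y assume "y \<in> {moment_vector \<gamma> E A (eval_fpoly (s * b)) | s. s \<in> sos_cone r \<rho>}"
    then obtain qs where qs: "set qs \<subseteq> bounded_polys r \<rho>"
      and y: "y = moment_vector \<gamma> E A (eval_fpoly ((\<Sum>q\<leftarrow>qs. herm_conj q * q) * b))"
      by (auto simp: sos_cone_def)
    obtain X where X: "\<forall>q\<in>bounded_polys r \<rho>.
      \<forall>c. eval_fpoly q c = (\<Sum>i<k. complex_of_real (X q i) * eval_fpoly (u i) c)"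
      using bchoice[OF u1] by (elim exE) (rule that)
    have "y = (\<Sum>q\<leftarrow>qs. f (X q))"
    proof -
      have "moment_vector \<gamma> E A (eval_fpoly (herm_conj q * q * b)) = f (X q)" if "q \<in> set qs" for q
        by (rule square[OF bspec[OF X subsetD[OF qs that]]])
      then show ?thesis unfolding y list by (intro arg_cong[of _ _ sum_list] map_cong refl)
    qed
    also have "\<dots> = (\<Sum>x\<leftarrow>map X qs. f x)" by (simp add: comp_def)
    finally show "y \<in> sos_values k z" unfolding sos_values_def f_def by blast
  next
    fix y assume "y \<in> sos_values k z"
    then obtain xs where y: "y = (\<Sum>x\<leftarrow>xs. f x)" by (auto simp: sos_values_def f_def)
    obtain P where "\<forall>x. P x \<in> bounded_polys r \<rho> \<and>
      (\<forall>c. eval_fpoly (P x) c = (\<Sum>i<k. complex_of_real (x i) * eval_fpoly (u i) c))"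
      using choice[OF u2[unfolded Bex_def]] by (elim exE) (rule that)
    then have P: "P x \<in> bounded_polys r \<rho>"
      "\<forall>c. eval_fpoly (P x) c = (\<Sum>i<k. complex_of_real (x i) * eval_fpoly (u i) c)" for x
      by blast+
    have "y = moment_vector \<gamma> E A (eval_fpoly ((\<Sum>q\<leftarrow>map P xs. herm_conj q * q) * b))"
      unfolding list y by (simp add: comp_def square[OF P(2)])
    moreover have "(\<Sum>q\<leftarrow>map P xs. herm_conj q * q) \<in> sos_cone r \<rho>"
      unfolding sos_cone_def using P(1) by (intro CollectI exI[of _ "map P xs"]) auto
    ultimately show "y \<in> {moment_vector \<gamma> E A (eval_fpoly (s * b)) | s. s \<in> sos_cone r \<rho>}" by blast
  qed
  then show ?thesis by blast
qed

lemma semidefinite_representable_moment_vectors: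
  "semidefinite_representable {moment_vector \<gamma> E A (eval_fpoly p) | p. p \<in> quadratic_module m r \<rho>}"
proof -
  let ?I = "\<lambda>p. moment_vector \<gamma> E A (eval_fpoly p)"
  \<comment> \<open>The factor 1 lets both summands of the quadratic module use the same result,
    with b = 1 and b = \<open>ball_poly m \<rho>\<close>.\<close>
  obtain k\<^sub>0 z\<^sub>0 where 0: "{?I (s * 1) | s. s \<in> sos_cone r \<rho>} = sos_values k\<^sub>0 z\<^sub>0"
    using moment_vectors_sos_cone by blast
  obtain k\<^sub>1 z\<^sub>1 where 1: "{?I (s * ball_poly m \<rho>) | s. s \<in> (if r = 0 then {0} else sos_cone (r - 1) \<rho>)}
    = sos_values k\<^sub>1 z\<^sub>1"
  proof (cases "r = 0")
    case True
    have "?I 0 = 0" using moment_vector_zero by (simp add: eval_fpoly_zero[abs_def])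
    \<comment> \<open>A quadratic form in no variables generates the zero cone.\<close>
    then have "{?I (s * ball_poly m \<rho>) | s. s \<in> (if r = 0 then {0} else sos_cone (r - 1) \<rho>)} = sos_values 0 (\<lambda>_ _. 0)"
      using True by (auto simp: sos_values_def)
    then show ?thesis by (rule that)
  next
    case False
    then show ?thesis using moment_vectors_sos_cone[of "ball_poly m \<rho>" "r - 1" \<rho>] that by auto
  qed
  have add: "?I (p + q) = ?I p + ?I q" for p q
    using moment_vector_add[OF continuous_on_eval_fpoly continuous_on_eval_fpoly, of p q]
    by (simp add: eval_fpoly_add[abs_def])
  have "{?I p | p. p \<in> quadratic_module m r \<rho>}
    = {?I (s\<^sub>0 * 1) + ?I (s\<^sub>1 * ball_poly m \<rho>) | s\<^sub>0 s\<^sub>1.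
        s\<^sub>0 \<in> sos_cone r \<rho> \<and> s\<^sub>1 \<in> (if r = 0 then {0} else sos_cone (r - 1) \<rho>)}"
    unfolding quadratic_module_def add[symmetric] by auto
  also have "\<dots> = {a + b | a b. a \<in> sos_values k\<^sub>0 z\<^sub>0 \<and> b \<in> sos_values k\<^sub>1 z\<^sub>1}"
    unfolding 0[symmetric] 1[symmetric] by blast
  finally show ?thesis by (simp only: sos_values_add semidefinite_representable_sos_values)
qed

end


section \<open>Transfer of the density to the Sobolev ball\<close>

lemma continuous_on_prod_mset_fourier_coeff: "continuous_on S (\<lambda>f. \<Prod>a\<in>#as. fourier_coeff f a)"
  by (induction as) (auto intro!: continuous_intros continuous_on_fourier_coeff)

theorem proposition8:
  fixes m r \<rho> :: nat
    and A :: "((int^'n) multiset)^'N"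
    and \<gamma> :: "(int^'n) ell2 measure"
  assumes "m \<ge> 1"
    and "radon_measure \<gamma>"
    and "AE c in \<gamma>. c \<in> fourier_map ` sobolev_ball m \<longrightarrow> hermitian_seq c"
  shows "semidefinite_representable (inner_cone m \<gamma> r \<rho> A)
    \<and> inner_cone m \<gamma> r \<rho> A \<subseteq> moment_cone m A"
proof
  let ?E = "sobolev_ellipsoid m :: (int^'n) ell2 set"
  have compact: "compact ?E" by (rule compact_sobolev_ellipsoid[OF assms(1)])
  have herm: "AE c in \<gamma>. c \<in> ?E \<longrightarrow> hermitian_seq c"
    using assms(3) by (simp add: fourier_map_sobolev_ball)
  have "inner_cone m \<gamma> r \<rho> A = {moment_vector \<gamma> ?E A (eval_fpoly p) | p. p \<in> quadratic_module m r \<rho>}"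
    unfolding inner_cone_def fourier_map_sobolev_ball moment_vector_def by (auto simp: vec_eq_iff)
  then show "semidefinite_representable (inner_cone m \<gamma> r \<rho> A)"
    using semidefinite_representable_moment_vectors[OF assms(2) compact herm] by simp
  show "inner_cone m \<gamma> r \<rho> A \<subseteq> moment_cone m A"
  proof
    fix y assume "y \<in> inner_cone m \<gamma> r \<rho> A"
    then obtain p where p: "p \<in> quadratic_module m r \<rho>"
      and y: "\<And>j. y $ j = (LINT c:?E|\<gamma>. eval_monom c (A $ j) * eval_fpoly p c)"
      unfolding inner_cone_def fourier_map_sobolev_ball by blast
    \<comment> \<open>The truncation gives a continuous density that is nonnegative everywhere and
      still agrees with p at Hermitian points of E.\<close>
    define h where "h c = max 0 (Re (eval_fpoly p c))" for c
    have p_eq: "eval_fpoly p c = complex_of_real (h c)" if "hermitian_seq c" "c \<in> ?E" for c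
      using eval_fpoly_quadratic_module[OF that p] by (auto simp: h_def)
    have h_nonneg: "0 \<le> h c" for c by (simp add: h_def)
    have h: "continuous_on UNIV h"
      unfolding h_def by (intro continuous_intros continuous_on_eval_fpoly)
    define \<mu> where "\<mu> = distr (density \<gamma> (\<lambda>c. ennreal (indicator ?E c * h c))) borel fourier_series"
    have sets[measurable_cong, simp]: "sets \<gamma> = sets borel" using assms(2) by (simp add: radon_measure_def)
    have [measurable]: "h \<in> borel_measurable borel" "fourier_series \<in> borel_measurable borel"
      by (intro borel_measurable_continuous_onI h continuous_on_fourier_series)+
    have [measurable]: "?E \<in> sets borel" "(sobolev_ball m :: 'n L2_torus set) \<in> sets borel"
      by (intro borel_closed compact_imp_closed compact closed_sobolev_ball)+
    have series_ball: "fourier_series c \<in> sobolev_ball m \<longleftrightarrow> c \<in> ?E" for c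
      by (simp add: sobolev_ball_iff)
    have "radon_measure \<mu>"
      unfolding \<mu>_def
      by (rule radon_measure_distr_density[OF assms(2) compact h h_nonneg continuous_on_fourier_series])
    moreover have "AE f in \<mu>. f \<in> sobolev_ball m"
      unfolding \<mu>_def
      by (subst AE_distr_iff) (auto simp: AE_density series_ball indicator_def)
    moreover have "y $ j = (LINT f:sobolev_ball m|\<mu>. \<Prod>a\<in>#A $ j. fourier_coeff f a)" for j
    proof -
      define g where "g f = (\<Prod>a\<in>#A $ j. fourier_coeff f a)" for f :: "'n L2_torus"
      have g_series: "g (fourier_series c) = eval_monom c (A $ j)" for c
        by (simp add: g_def eval_monom_def)
      have "continuous_on UNIV g"
        unfolding g_def by (rule continuous_on_prod_mset_fourier_coeff)
      then have [measurable]: "g \<in> borel_measurable borel" by (rule borel_measurable_continuous_onI)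
      \<comment> \<open>Change of variables along synthesis, which turns the indicator of the ball
        into that of E and leaves the coefficients unchanged.\<close>
      have "(LINT f:sobolev_ball m|\<mu>. g f)
        = (\<integral>c. indicator (sobolev_ball m) (fourier_series c) *\<^sub>R g (fourier_series c)
            \<partial>density \<gamma> (\<lambda>c. ennreal (indicator ?E c * h c)))"
        unfolding \<mu>_def set_lebesgue_integral_def by (rule integral_distr) measurable
      also have "\<dots> = (\<integral>c. (indicator ?E c * h c) *\<^sub>R
          (indicator (sobolev_ball m) (fourier_series c) *\<^sub>R g (fourier_series c)) \<partial>\<gamma>)"
        by (rule integral_density) (measurable, simp add: h_nonneg)
      also have "\<dots> = (LINT c:?E|\<gamma>. eval_monom c (A $ j) * eval_fpoly p c)"
        unfolding set_lebesgue_integral_def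
      proof (rule integral_cong_AE)
        show "AE c in \<gamma>. (indicator ?E c * h c) *\<^sub>R
            (indicator (sobolev_ball m) (fourier_series c) *\<^sub>R g (fourier_series c))
          = indicator ?E c *\<^sub>R (eval_monom c (A $ j) * eval_fpoly p c)"
          using herm
        proof eventually_elim
          case (elim c)
          then show ?case
            by (cases "c \<in> ?E") (simp_all add: p_eq series_ball g_series scaleR_conv_of_real)
        qed
        have "(\<lambda>c. eval_monom c (A $ j) * eval_fpoly p c) \<in> borel_measurable borel"
          by (intro borel_measurable_continuous_onI continuous_intros continuous_on_eval_monom continuous_on_eval_fpoly)
        then show "(\<lambda>c. indicator ?E c *\<^sub>R (eval_monom c (A $ j) * eval_fpoly p c)) \<in> borel_measurable \<gamma>"
          by measurable
      qed measurable
      finally show ?thesis by (simp add: y g_def)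
    qed
    ultimately show "y \<in> moment_cone m A" unfolding moment_cone_def by blast
  qed
qed

end
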